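(* Let $Q$ be a quadrangulation with $n$ vertices and a strong labeling, and number its vertices $v_1,\dots,v_n$ so that $f_1(v_1)<f_1(v_2)<\dots<f_1(v_n)$ (these values are pairwise distinct). Place the vertices in this order on a line, and draw the edges of $T_0$ as arcs on one side of the line and the edges of $T_1$ as arcs on the other side. Then, for each $\ell\in\{0,1\}$, the tree $T_\ell$ is non-crossing, i.e. there are no two edges $v_av_c$ and $v_bv_d$ of $T_\ell$ with $a<b<c<d$, and alternating, i.e. there are no two edges $v_iv_j$ and $v_jv_k$ of $T_\ell$ with $i<j<k$. In particular this gives a $2$-book embedding of $Q$ with one tree on each page.
   Context: A quadrangulation is a simple plane graph with at least four vertices all of whose faces (including the outer face) are bounded by $4$-cycles; it is bipartite, with vertices properly colored black and white; it has $n-3$ bounded faces. An angle is an incidence of a vertex with a face. A strong labeling of $Q$ is a map from the angles of $Q$ to $\{0,1\}$ such that: (G0) the two black vertices on the outer face are named $s_0$ and $s_1$, and all angles at $s_i$ are labeled $i$; (G1) for each vertex $v\notin\{s_0,s_1\}$ the labels around $v$ form one non-empty cyclic interval of $1$s and one non-empty cyclic interval of $0$s; (G2) for each edge, the two labels on the two sides of the edge coincide at one endpoint and differ at the other; (G3) the labels in each bounded face, read cyclically, are $0,0,1,1$, and reading the labels of the outer face in clockwise order starting at $s_0$ they are $0,0,1,1$. Each edge is colored with the common label at the endpoint where its two labels coincide and oriented towards that endpoint; $T_i$ is the set of edges of color $i$; each $T_i$ is a directed tree with sink $s_i$ spanning all vertices but $s_{1-i}$, and $T_0\cup T_1$ is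 the whole edge set. For a non-special vertex $v$, $P_i(v)$ is the directed path in $T_i$ from $v$ to $s_i$; $P_0(v)$ and $P_1(v)$ share only $v$ and split the quadrangulation into two regions, $R_i(v)$ being the region to the right of $P_i(v)$, including both paths. For non-special $v$, $f_i(v)$ is the number of bounded faces contained in $R_i(v)$; for the special vertices $f_0(s_0)=f_1(s_1)=-1$ and $f_1(s_0)=f_0(s_1)=n-2$. One has $f_0(v)+f_1(v)=n-3$ for every vertex. *)

theory Defs
  imports Main
begin

text \<open>
  Combinatorial model of a plane graph: a rotation system.
  V is the vertex set, E the set of darts (ordered pairs (u,w), one for each
  direction of each edge; E is symmetric and irreflexive, so the graph is simple),
  rot d is the next dart counterclockwise around the tail fst d of d.
  Faces are the orbits of phi d = rot (reverse d); with rot counterclockwise, the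
  face of a dart d lies to the right of d.  The angle (corner) indexed by a dart e is
  the corner at fst e between the dart preceding e around fst e and e itself; it lies
  in the face of e.  Thus angles correspond bijectively to darts.
\<close>

definition darts_at :: "('v \<times> 'v) set \<Rightarrow> 'v \<Rightarrow> ('v \<times> 'v) set" where
  "darts_at E u = {d \<in> E. fst d = u}"

definition phi :: "('v \<times> 'v \<Rightarrow> 'v \<times> 'v) \<Rightarrow> 'v \<times> 'v \<Rightarrow> 'v \<times> 'v" where
  "phi rot d = rot (snd d, fst d)"

definition face_of :: "('v \<times> 'v \<Rightarrow> 'v \<times> 'v) \<Rightarrow> 'v \<times> 'v \<Rightarrow> ('v \<times> 'v) set" where
  "face_of rot d = range (\<lambda>k::nat. (phi rot ^^ k) d)"

definition faces :: "('v \<times> 'v) set \<Rightarrow> ('v \<times> 'v \<Rightarrow> 'v \<times> 'v) \<Rightarrow> ('v \<times> 'v) set set" where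
  "faces E rot = face_of rot ` E"

definition rotation_system :: "'v set \<Rightarrow> ('v \<times> 'v) set \<Rightarrow> ('v \<times> 'v \<Rightarrow> 'v \<times> 'v) \<Rightarrow> bool" where
  "rotation_system V E rot \<longleftrightarrow>
     finite V \<and> E \<subseteq> V \<times> V \<and>
     (\<forall>(u,w)\<in>E. u \<noteq> w \<and> (w,u) \<in> E) \<and>
     bij_betw rot E E \<and>
     (\<forall>d\<in>E. fst (rot d) = fst d) \<and>
     (\<forall>d\<in>E. \<forall>d'\<in>E. fst d = fst d' \<longrightarrow> (\<exists>k::nat. (rot ^^ k) d = d'))"

text \<open>Plane (genus 0) connected simple graph: Euler's formula V - E + F = 2.\<close>
definition plane_graph :: "'v set \<Rightarrow> ('v \<times> 'v) set \<Rightarrow> ('v \<times> 'v \<Rightarrow> 'v \<times> 'v) \<Rightarrow> bool" where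
  "plane_graph V E rot \<longleftrightarrow>
     rotation_system V E rot \<and>
     (\<forall>u\<in>V. \<forall>w\<in>V. (u,w) \<in> E\<^sup>*) \<and>
     int (card V) - int (card E div 2) + int (card (faces E rot)) = 2"

text \<open>Quadrangulation with outer face (the face of dart dout) and a proper
  black/white colouring (black v = True means v is black).\<close>
definition quadrangulation ::
  "'v set \<Rightarrow> ('v \<times> 'v) set \<Rightarrow> ('v \<times> 'v \<Rightarrow> 'v \<times> 'v) \<Rightarrow> 'v \<times> 'v \<Rightarrow> ('v \<Rightarrow> bool) \<Rightarrow> bool" where
  "quadrangulation V E rot dout black \<longleftrightarrow>
     plane_graph V E rot \<and> card V \<ge> 4 \<and> dout \<in> E \<and>
     (\<forall>d\<in>E. (phi rot ^^ 4) d = d \<and> card ((\<lambda>k. fst ((phi rot ^^ k) d)) ` {0..<4}) = 4) \<and>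
     (\<forall>(u,w)\<in>E. black u \<noteq> black w)"

definition outer_face :: "('v \<times> 'v \<Rightarrow> 'v \<times> 'v) \<Rightarrow> 'v \<times> 'v \<Rightarrow> ('v \<times> 'v) set" where
  "outer_face rot dout = face_of rot dout"

definition bounded_faces ::
  "('v \<times> 'v) set \<Rightarrow> ('v \<times> 'v \<Rightarrow> 'v \<times> 'v) \<Rightarrow> 'v \<times> 'v \<Rightarrow> ('v \<times> 'v) set set" where
  "bounded_faces E rot dout = faces E rot - {outer_face rot dout}"

text \<open>Strong labeling: lab assigns to every angle (= dart, see above) a label in {0,1}.\<close>
definition strong_labeling ::
  "'v set \<Rightarrow> ('v \<times> 'v) set \<Rightarrow> ('v \<times> 'v \<Rightarrow> 'v \<times> 'v) \<Rightarrow> 'v \<times> 'v \<Rightarrow> ('v \<Rightarrow> bool)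
     \<Rightarrow> 'v \<Rightarrow> 'v \<Rightarrow> ('v \<times> 'v \<Rightarrow> nat) \<Rightarrow> bool" where
  "strong_labeling V E rot dout black s0 s1 lab \<longleftrightarrow>
     (\<forall>d\<in>E. lab d \<in> {0,1}) \<and>
     \<comment> \<open>(G0)\<close>
     s0 \<noteq> s1 \<and> black s0 \<and> black s1 \<and>
     s0 \<in> fst ` outer_face rot dout \<and> s1 \<in> fst ` outer_face rot dout \<and>
     (\<forall>d\<in>E. fst d = s0 \<longrightarrow> lab d = 0) \<and>
     (\<forall>d\<in>E. fst d = s1 \<longrightarrow> lab d = 1) \<and>
     \<comment> \<open>(G1)\<close>
     (\<forall>v\<in>V - {s0, s1}. \<exists>d\<in>darts_at E v. \<exists>k. 0 < k \<and> k < card (darts_at E v) \<and>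
        (\<forall>j < card (darts_at E v). lab ((rot ^^ j) d) = (if j < k then 1 else 0))) \<and>
     \<comment> \<open>(G2): labels on the two sides of edge uw at u are those of angles (u,w) and rot (u,w)\<close>
     (\<forall>(u,w)\<in>E. (lab (u,w) = lab (rot (u,w))) \<noteq> (lab (w,u) = lab (rot (w,u)))) \<and>
     \<comment> \<open>(G3), bounded faces\<close>
     (\<forall>d\<in>E. face_of rot d \<noteq> outer_face rot dout \<longrightarrow>
        (\<exists>j<4. lab ((phi rot ^^ j) d) = 0 \<and> lab ((phi rot ^^ (j+1)) d) = 0 \<and>
               lab ((phi rot ^^ (j+2)) d) = 1 \<and> lab ((phi rot ^^ (j+3)) d) = 1)) \<and>
     \<comment> \<open>(G3), outer face read clockwise from s0, i.e. in reverse phi-order\<close>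
     (\<exists>d\<in>outer_face rot dout. fst d = s0 \<and> lab d = 0 \<and>
        lab ((phi rot ^^ 3) d) = 0 \<and> lab ((phi rot ^^ 2) d) = 1 \<and> lab (phi rot d) = 1)"

text \<open>Arcs of T_i: edge uw has colour i and is oriented towards u when its two labels
  coincide at u with common value i.  Arc (w,u) means w \<rightarrow> u.\<close>
definition tree_arcs ::
  "('v \<times> 'v) set \<Rightarrow> ('v \<times> 'v \<Rightarrow> 'v \<times> 'v) \<Rightarrow> ('v \<times> 'v \<Rightarrow> nat) \<Rightarrow> nat \<Rightarrow> ('v \<times> 'v) set" where
  "tree_arcs E rot lab i = {(w,u) | u w. (u,w) \<in> E \<and> lab (u,w) = i \<and> lab (rot (u,w)) = i}"

definition tree_edge ::
  "('v \<times> 'v) set \<Rightarrow> ('v \<times> 'v \<Rightarrow> 'v \<times> 'v) \<Rightarrow> ('v \<times> 'v \<Rightarrow> nat) \<Rightarrow> nat \<Rightarrow> 'v \<Rightarrow> 'v \<Rightarrow> bool" where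
  "tree_edge E rot lab i a b \<longleftrightarrow> (a,b) \<in> tree_arcs E rot lab i \<or> (b,a) \<in> tree_arcs E rot lab i"

text \<open>Arcs of the directed path P_i(v) from v to s_i in T_i.\<close>
definition path_arcs ::
  "('v \<times> 'v) set \<Rightarrow> ('v \<times> 'v \<Rightarrow> 'v \<times> 'v) \<Rightarrow> ('v \<times> 'v \<Rightarrow> nat) \<Rightarrow> nat \<Rightarrow> 'v \<Rightarrow> ('v \<times> 'v) set" where
  "path_arcs E rot lab i v =
     {(x,y) \<in> tree_arcs E rot lab i. (v,x) \<in> (tree_arcs E rot lab i)\<^sup>*}"

text \<open>Both darts of every edge of P_0(v) \<union> P_1(v).\<close>
definition path_darts ::
  "('v \<times> 'v) set \<Rightarrow> ('v \<times> 'v \<Rightarrow> 'v \<times> 'v) \<Rightarrow> ('v \<times> 'v \<Rightarrow> nat) \<Rightarrow> 'v \<Rightarrow> ('v \<times> 'v) set" where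
  "path_darts E rot lab v =
     {(x,y). (x,y) \<in> path_arcs E rot lab 0 v \<union> path_arcs E rot lab 1 v \<or>
             (y,x) \<in> path_arcs E rot lab 0 v \<union> path_arcs E rot lab 1 v}"

text \<open>Bounded faces of R_i(v): the bounded faces lying immediately to the right of an
  arc of P_i(v), and all bounded faces reachable from them in the dual graph without
  crossing an edge of P_0(v) \<union> P_1(v) (and without passing through the outer face).\<close>
definition region_faces ::
  "('v \<times> 'v) set \<Rightarrow> ('v \<times> 'v \<Rightarrow> 'v \<times> 'v) \<Rightarrow> 'v \<times> 'v \<Rightarrow> ('v \<times> 'v \<Rightarrow> nat) \<Rightarrow> nat \<Rightarrow> 'v
     \<Rightarrow> ('v \<times> 'v) set set" where
  "region_faces E rot dout lab i v =
     (let B = bounded_faces E rot dout;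
          start = B \<inter> face_of rot ` path_arcs E rot lab i v;
          adj = {(F,G). F \<in> B \<and> G \<in> B \<and>
                   (\<exists>d\<in>F. d \<notin> path_darts E rot lab v \<and> (snd d, fst d) \<in> G)}
      in {G \<in> B. \<exists>F\<in>start. (F,G) \<in> adj\<^sup>*})"

definition fval ::
  "'v set \<Rightarrow> ('v \<times> 'v) set \<Rightarrow> ('v \<times> 'v \<Rightarrow> 'v \<times> 'v) \<Rightarrow> 'v \<times> 'v \<Rightarrow> 'v \<Rightarrow> 'v
     \<Rightarrow> ('v \<times> 'v \<Rightarrow> nat) \<Rightarrow> nat \<Rightarrow> 'v \<Rightarrow> int" where
  "fval V E rot dout s0 s1 lab i v =
     (if v = (if i = 0 then s0 else s1) then -1
      else if v = (if i = 0 then s1 else s0) then int (card V) - 2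
      else int (card (region_faces E rot dout lab i v)))"

end

theory Submission
  imports Defs
begin

text \<open>
  In every face the label changes along exactly those edges whose tail, in the direction of
  \<^const>\<open>phi\<close>, is black. Hence at an inner vertex the two places where the labels change are
  its outgoing edges, one of each colour. The equator is the closed curve that
  crosses every face once, separating its edges of colour 0 from those of colour 1, and
  passes once through every vertex other than \<open>s\<^sub>0\<close> and \<open>s\<^sub>1\<close>. Walking around the component of
  \<open>s\<^sub>0\<close> in \<open>T\<^sub>0\<close> one follows the equator: the subtree of each vertex \<open>c\<close> is a contiguous run, entered
  from the face on one side of the edge leaving \<open>c\<close> and left to the face on the other
  side, and \<open>c\<close> is its last vertex if black and its first if white. Exchanging the labels gives the same
  for \<open>T\<^sub>1\<close>; both walks start in the outer face, so they describe the same closed curve, and by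
  connectedness it meets all vertices. Edges not on \<open>P\<^sub>0(v) \<union> P\<^sub>1(v)\<close> bound runs that avoid
  \<open>v\<close>, so \<open>R\<^sub>1(v)\<close> consists of the bounded faces met before \<open>v\<close> and \<open>f\<^sub>1(v)\<close> is the position of
  \<open>v\<close> on the equator. Non-crossing and alternation are properties of the runs. Euler's formula is
  not needed: the labeling already forces genus 0.
\<close>

section \<open>Walks through faces, given as lists of vertices\<close>

abbreviation rv :: "'v \<times> 'v \<Rightarrow> 'v \<times> 'v" where
  "rv d \<equiv> (snd d, fst d)"

text \<open>Each vertex is a passage from one face to another, given by \<open>a\<close> and
  \<open>b\<close>. These are parameters so that the reversed list is again a \<open>run\<close>,
  with the two exchanged.\<close>

primrec run :: "('v \<Rightarrow> 'f) \<Rightarrow> ('v \<Rightarrow> 'f) \<Rightarrow> 'f \<Rightarrow> 'v list \<Rightarrow> 'f \<Rightarrow> bool" where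
  "run a b F [] G \<longleftrightarrow> F = G"
| "run a b F (v # vs) G \<longleftrightarrow> a v = F \<and> run a b (b v) vs G"

lemma run_append: "run a b F (xs @ ys) G \<longleftrightarrow> (\<exists>H. run a b F xs H \<and> run a b H ys G)"
  by (induction xs arbitrary: F) auto

lemma run_rev: "run b a G (rev xs) F \<longleftrightarrow> run a b F xs G"
  by (induction xs arbitrary: F) (auto simp: run_append)

lemma run_hd_last: "run a b F xs G \<Longrightarrow> xs \<noteq> [] \<Longrightarrow> a (hd xs) = F \<and> b (last xs) = G"
proof (induction xs arbitrary: F)
  case (Cons v vs)
  then show ?case by (cases vs) auto
qed simp

lemma run_nth: "run a b F xs G \<Longrightarrow> Suc i < length xs \<Longrightarrow> b (xs ! i) = a (xs ! Suc i)"
proof (induction xs arbitrary: F i)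
  case (Cons v vs)
  then show ?case by (cases vs; cases i) auto
qed simp

text \<open>By injectivity of \<open>a\<close> the current face determines the next vertex, so two
  walks from the same face agree until one of them stops.\<close>

lemma run_prefix:
  assumes "run a b F xs G" "run a b F ys H" "inj_on a (set xs \<union> set ys)"
  shows "\<exists>zs. ys = xs @ zs \<or> xs = ys @ zs"
  using assms
proof (induction xs arbitrary: F ys)
  case (Cons v vs)
  show ?case
  proof (cases ys)
    case (Cons w ws)
    then have "w = v"
      using Cons.prems by (auto dest: inj_onD)
    moreover have "\<exists>zs. ws = vs @ zs \<or> vs = ws @ zs"
      using Cons.prems \<open>w = v\<close> Cons by (intro Cons.IH[of "b v"]) (auto intro: inj_on_subset)
    ultimately show ?thesis
      using Cons by auto
  qed simp
qed auto

text \<open>If the walk went on after closing up, its next vertex would be entered from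
  \<open>F\<close>, like the first one, and would repeat it.\<close>

lemma closed_run_not_extended:
  assumes "run a b F xs F" "run a b F (xs @ zs) F" "xs \<noteq> []" "distinct (xs @ zs)"
    "inj_on a (set (xs @ zs))"
  shows "zs = []"
proof (rule ccontr)
  assume "zs \<noteq> []"
  obtain H where H: "run a b F xs H" "run a b H zs F"
    using assms(2) by (auto simp: run_append)
  then have "H = F"
    using run_hd_last[OF H(1)] run_hd_last[OF assms(1)] assms(3) by simp
  then have "a (hd zs) = a (hd xs)"
    using run_hd_last[OF H(2)] run_hd_last[OF assms(1)] assms(3) \<open>zs \<noteq> []\<close> by simp
  then have "hd zs = hd xs"
    using assms(3,5) \<open>zs \<noteq> []\<close> by (auto dest!: inj_onD)
  then show False
    using assms(3,4) \<open>zs \<noteq> []\<close> by (metis IntI distinct_append empty_iff hd_in_set)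
qed

lemma closed_run_unique:
  assumes "run a b F xs F" "run a b F ys F" "xs \<noteq> []" "ys \<noteq> []" "distinct xs" "distinct ys"
    "inj_on a (set xs \<union> set ys)"
  shows "xs = ys"
proof -
  obtain zs where "ys = xs @ zs \<or> xs = ys @ zs"
    using run_prefix[OF assms(1,2,7)] by blast
  then show ?thesis
  proof
    assume z: "ys = xs @ zs"
    then have "zs = []"
      using assms by (intro closed_run_not_extended[of a b F xs]) (auto intro: inj_on_subset)
    then show ?thesis using z by simp
  next
    assume z: "xs = ys @ zs"
    then have "zs = []"
      using assms by (intro closed_run_not_extended[of a b F ys]) (auto intro: inj_on_subset)
    then show ?thesis using z by simp
  qed
qed

subsection \<open>Rotation systems with quadrangular faces\<close>

locale quad_map =
  fixes V :: "'v set" and E :: "('v \<times> 'v) set" and rot :: "'v \<times> 'v \<Rightarrow> 'v \<times> 'v"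
    and black :: "'v \<Rightarrow> bool"
  assumes finite_V: "finite V"
    and E_subset: "E \<subseteq> V \<times> V"
    and rv_in: "d \<in> E \<Longrightarrow> rv d \<in> E"
    and rot_in: "d \<in> E \<Longrightarrow> rot d \<in> E"
    and fst_rot: "d \<in> E \<Longrightarrow> fst (rot d) = fst d"
    and inj_rot: "inj_on rot E"
    and rot_orbit: "\<lbrakk>d \<in> E; d' \<in> E; fst d = fst d'\<rbrakk> \<Longrightarrow> \<exists>k::nat. (rot ^^ k) d = d'"
    and phi4: "d \<in> E \<Longrightarrow> (phi rot ^^ 4) d = d"
    and bipartite: "d \<in> E \<Longrightarrow> black (snd d) = (\<not> black (fst d))"
    and connected: "\<lbrakk>u \<in> V; w \<in> V\<rbrakk> \<Longrightarrow> (u, w) \<in> E\<^sup>*"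
begin

abbreviation fc where "fc \<equiv> face_of rot"

lemma phi_in: "d \<in> E \<Longrightarrow> phi rot d \<in> E"
  using rot_in[OF rv_in] by (simp add: phi_def)

lemma fst_phi: "d \<in> E \<Longrightarrow> fst (phi rot d) = snd d"
  using fst_rot[OF rv_in] by (simp add: phi_def)

lemma phi4': "d \<in> E \<Longrightarrow> phi rot (phi rot (phi rot (phi rot d))) = d"
  using phi4[of d] by (simp add: eval_nat_numeral)

lemma rot_pow_in: "d \<in> E \<Longrightarrow> (rot ^^ k) d \<in> E"
  by (induction k) (auto intro: rot_in)

lemma fst_rot_pow: "d \<in> E \<Longrightarrow> fst ((rot ^^ k) d) = fst d"
  by (induction k) (auto simp: fst_rot rot_pow_in)

lemma fc_eq:
  assumes "d \<in> E"
  shows "fc d = {d, phi rot d, phi rot (phi rot d), phi rot (phi rot (phi rot d))}"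
proof -
  let ?X = "{d, phi rot d, phi rot (phi rot d), phi rot (phi rot (phi rot d))}"
  have "(phi rot ^^ k) d \<in> ?X" for k
  proof (induction k)
    case (Suc k)
    then show ?case
      by (elim insertE) (simp_all add: phi4'[OF assms])
  qed simp
  moreover have "?X = (\<lambda>k. (phi rot ^^ k) d) ` {0, 1, 2, 3}"
    by (simp add: eval_nat_numeral)
  ultimately show ?thesis
    unfolding face_of_def by blast
qed

lemma in_fc: "d \<in> E \<Longrightarrow> d \<in> fc d"
  by (simp add: fc_eq)

lemma fc_phi: "d \<in> E \<Longrightarrow> fc (phi rot d) = fc d"
  by (simp add: fc_eq phi_in phi4') blast

lemma fc_rot: "d \<in> E \<Longrightarrow> fc (rot d) = fc (rv d)"
  using fc_phi[OF rv_in, of d] by (simp add: phi_def)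

lemma fc_rot_rv: "d \<in> E \<Longrightarrow> fc (rot (rv d)) = fc d"
  using fc_rot[OF rv_in, of d] by simp

lemma fc_mem:
  assumes "d \<in> E" "e \<in> fc d"
  shows "e \<in> E \<and> fc e = fc d"
proof -
  from assms(2)[unfolded fc_eq[OF assms(1)]] show ?thesis
    by (elim insertE emptyE) (simp_all add: assms(1) phi_in fc_phi)
qed

lemma rot_pow_cancel:
  assumes "d \<in> E" "(rot ^^ i) d = (rot ^^ j) d" "i \<le> j"
  shows "(rot ^^ (j - i)) d = d"
  using assms(2,3)
proof (induction i arbitrary: j)
  case (Suc i)
  then obtain k where j: "j = Suc k" by (cases j) auto
  then have "(rot ^^ i) d = (rot ^^ k) d"
    using Suc.prems inj_onD[OF inj_rot] assms(1) by (simp add: rot_pow_in)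
  then show ?case
    using Suc.IH[of k] Suc.prems j by simp
qed simp

lemma rot_cycle:
  assumes d: "d \<in> E"
  shows "(rot ^^ card (darts_at E (fst d))) d = d \<and>
    darts_at E (fst d) = (\<lambda>j. (rot ^^ j) d) ` {..<card (darts_at E (fst d))} \<and>
    inj_on (\<lambda>j. (rot ^^ j) d) {..<card (darts_at E (fst d))}"
proof -
  let ?P = "\<lambda>m. 0 < m \<and> (rot ^^ m) d = d"
  obtain k where "(rot ^^ k) (rot d) = d"
    using rot_orbit[of "rot d" d] d by (auto simp: rot_in fst_rot)
  then have ex: "?P (Suc k)"
    by (simp add: funpow_swap1)
  \<comment> \<open>The least positive period turns out to be the degree: exponents modulo
    \<open>m\<close> reach all darts at the vertex, and minimality keeps the darts below
    \<open>m\<close> distinct.\<close>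
  define m where "m = (LEAST m. ?P m)"
  have m: "?P m"
    unfolding m_def by (rule LeastI[of ?P, OF ex])
  have least: "m \<le> j" if "?P j" for j
    unfolding m_def using that by (rule Least_le)
  have set: "darts_at E (fst d) = (\<lambda>j. (rot ^^ j) d) ` {..<m}"
  proof
    show "darts_at E (fst d) \<subseteq> (\<lambda>j. (rot ^^ j) d) ` {..<m}"
    proof
      fix e assume "e \<in> darts_at E (fst d)"
      then obtain k where "(rot ^^ k) d = e"
        using rot_orbit[OF d, of e] by (auto simp: darts_at_def)
      then have "e = (rot ^^ (k mod m)) d"
        using m by (simp add: funpow_mod_eq)
      then show "e \<in> (\<lambda>j. (rot ^^ j) d) ` {..<m}"
        using m by auto
    qed
    show "(\<lambda>j. (rot ^^ j) d) ` {..<m} \<subseteq> darts_at E (fst d)"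
      using d by (auto simp: darts_at_def rot_pow_in fst_rot_pow)
  qed
  have inj: "inj_on (\<lambda>j. (rot ^^ j) d) {..<m}"
  proof (rule linorder_inj_onI)
    fix i j assume ij: "i < j" "i \<in> {..<m}" "j \<in> {..<m}"
    show "(rot ^^ i) d \<noteq> (rot ^^ j) d"
      using rot_pow_cancel[OF d, of i j] least[of "j - i"] ij by auto
  qed auto
  have "card (darts_at E (fst d)) = m"
    unfolding set by (simp add: card_image[OF inj])
  then show ?thesis
    using m set inj by simp
qed

text \<open>Around the pattern 0, 0, 1, 1 the label is alternately kept and changed. The place where
  the pattern starts varies, so \<open>d\<close> is any dart of the face.\<close>

lemma face_alternates:
  assumes "e \<in> E" "d \<in> fc e"
    and "\<not> L e" "\<not> L (phi rot e)" "L (phi rot (phi rot e))" "L (phi rot (phi rot (phi rot e)))"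
  shows "(L (phi rot d) = L d) \<noteq> (L (phi rot (phi rot d)) = L (phi rot d))"
  using assms(2)[unfolded fc_eq[OF assms(1)]]
  by (elim insertE emptyE) (simp_all add: assms(3-6) phi4'[OF assms(1)])

text \<open>Whether the label changes along a dart alternates around each face by (G3) and across
  each edge by (G2), as does the colour of the tail.\<close>
lemma label_change:
  assumes alt: "\<And>d. d \<in> E \<Longrightarrow>
      (L (phi rot d) = L d) \<noteq> (L (phi rot (phi rot d)) = L (phi rot d))"
    and edge: "\<And>d. d \<in> E \<Longrightarrow> (L d = L (rot d)) \<noteq> (L (rv d) = L (rot (rv d)))"
    and d0: "d0 \<in> E" "L (phi rot d0) = (L d0 \<noteq> black (fst d0))"
    and d: "d \<in> E"
  shows "L (phi rot d) = (L d \<noteq> black (fst d))"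
proof -
  let ?P = "\<lambda>d. L (phi rot d) = (L d \<noteq> black (fst d))"
  have P_rv: "?P (rv d)" if "d \<in> E" "?P d" for d
    using edge[OF that(1)] that(2) bipartite[OF that(1)] by (auto simp: phi_def)
  have P_phi: "?P (phi rot d)" if "d \<in> E" "?P d" for d
    using alt[OF that(1)] that(2) bipartite[OF that(1)] by (auto simp: fst_phi[OF that(1)])
  \<comment> \<open>Rotation is reversal followed by \<open>phi\<close>, so the rule spreads around
    a vertex; connectedness then carries it to all vertices.\<close>
  have P_rot: "?P (rot d)" if "d \<in> E" "?P d" for d
    using P_phi[OF rv_in P_rv, OF that(1) that] by (simp add: phi_def)
  have P_pow: "?P ((rot ^^ k) d)" if "d \<in> E" "?P d" for d k
  proof (induction k)
    case (Suc k)
    then show ?case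
      using P_rot[OF rot_pow_in[OF that(1)]] by simp
  qed (simp add: that(2))
  have P_at: "?P e" if "d \<in> E" "?P d" "e \<in> E" "fst e = fst d" for d e
    using rot_orbit[OF that(1,3)] P_pow[OF that(1,2)] that(4) by metis
  have "(fst d0, fst d) \<in> E\<^sup>*"
    using subsetD[OF E_subset d0(1)] subsetD[OF E_subset d]
    by (intro connected) (simp_all add: mem_Times_iff)
  then have "\<forall>e\<in>E. fst e = fst d \<longrightarrow> ?P e"
  proof induction
    case base
    then show ?case using P_at[OF d0] by blast
  next
    case (step u w)
    have "?P (u, w)"
      using step by simp
    then have "?P (rv (u, w))"
      using P_rv[OF step.hyps(2)] by blast
    moreover have "rv (u, w) \<in> E"
      using rv_in[OF step.hyps(2)] .
    ultimately show ?case
      using P_at[of "rv (u, w)"] by simp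
  qed
  then show ?thesis using d by blast
qed

text \<open>Converts the cyclic form of (G1) into one fan for each label: \<open>m + 1\<close>
  consecutive darts carrying it, followed by a dart carrying the other label.\<close>

lemma cyclic_intervals:
  assumes d: "d \<in> E" "fst d = v" and k: "0 < k" "k < card (darts_at E v)"
    and L: "\<forall>j<card (darts_at E v). L ((rot ^^ j) d) = (j < k)"
  shows "\<exists>d\<in>E. \<exists>m. fst d = v \<and> (\<forall>j\<le>m. \<not> L ((rot ^^ j) d)) \<and>
      L ((rot ^^ Suc m) d) \<and> {e \<in> E. fst e = v \<and> \<not> L e} = (\<lambda>j. (rot ^^ j) d) ` {..m}" (is ?fan0)
    and "\<exists>d\<in>E. \<exists>m. fst d = v \<and> (\<forall>j\<le>m. L ((rot ^^ j) d)) \<and>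
      \<not> L ((rot ^^ Suc m) d) \<and> {e \<in> E. fst e = v \<and> L e} = (\<lambda>j. (rot ^^ j) d) ` {..m}" (is ?fan1)
proof -
  define D where "D = card (darts_at E v)"
  note k = k[folded D_def] and L = L[folded D_def]
  have cyc: "(rot ^^ D) d = d" "darts_at E v = (\<lambda>j. (rot ^^ j) d) ` {..<D}"
    using rot_cycle[OF d(1)] d(2) by (simp_all add: D_def)
  have all: "{e \<in> E. fst e = v \<and> Q e} = (\<lambda>j. (rot ^^ j) d) ` {j. j < D \<and> Q ((rot ^^ j) d)}" for Q
  proof -
    have "{e \<in> E. fst e = v \<and> Q e} = {e \<in> darts_at E v. Q e}"
      by (auto simp: darts_at_def)
    also have "\<dots> = (\<lambda>j. (rot ^^ j) d) ` {j. j < D \<and> Q ((rot ^^ j) d)}"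
      unfolding cyc(2) by blast
    finally show ?thesis .
  qed
  show ?fan1
  proof (intro bexI exI conjI)
    show "fst d = v" "d \<in> E" by fact+
    show "\<forall>j\<le>k - 1. L ((rot ^^ j) d)" "\<not> L ((rot ^^ Suc (k - 1)) d)"
      using k L by auto
    have "{j. j < D \<and> L ((rot ^^ j) d)} = {..k - 1}"
      using k L by auto
    then show "{e \<in> E. fst e = v \<and> L e} = (\<lambda>j. (rot ^^ j) d) ` {..k - 1}"
      using all[of L] by simp
  qed
  \<comment> \<open>The zeros occupy the exponents from \<open>k\<close> to \<open>D - 1\<close>;
    counted from \<open>(rot ^^ k) d\<close>, the last one is \<open>D - 1 - k\<close>.\<close>
  define m where "m = D - 1 - k"
  have m: "Suc m + k = D" using k by (simp add: m_def)
  have shift: "(rot ^^ j) ((rot ^^ k) d) = (rot ^^ (j + k)) d" for j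
    by (simp add: funpow_add)
  show ?fan0
  proof (intro bexI exI conjI)
    show "(rot ^^ k) d \<in> E" "fst ((rot ^^ k) d) = v"
      using d by (simp_all add: rot_pow_in fst_rot_pow)
    show "\<forall>j\<le>m. \<not> L ((rot ^^ j) ((rot ^^ k) d))"
      unfolding shift using m L by auto
    \<comment> \<open>After the last zero the rotation is back at \<open>d\<close>, whose label is 1
      because \<open>0 < k\<close>.\<close>
    show "L ((rot ^^ Suc m) ((rot ^^ k) d))"
      unfolding shift m cyc(1) using L k by (metis funpow_0 gr_zeroI less_trans)
    have "{j. j < D \<and> \<not> L ((rot ^^ j) d)} = (\<lambda>j. j + k) ` {..m}"
    proof (intro set_eqI iffI)
      fix i assume "i \<in> {j. j < D \<and> \<not> L ((rot ^^ j) d)}"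
      then have "k \<le> i" "i - k \<le> m"
        using L m by auto
      then show "i \<in> (\<lambda>j. j + k) ` {..m}"
        by (intro image_eqI[of _ _ "i - k"]) auto
    qed (use L m in auto)
    then show "{e \<in> E. fst e = v \<and> \<not> L e} = (\<lambda>j. (rot ^^ j) ((rot ^^ k) d)) ` {..m}"
      unfolding shift all[of "\<lambda>e. \<not> L e"] by (simp add: image_image)
  qed
qed

end

subsection \<open>Labels, outgoing edges and the equator\<close>

text \<open>\<open>L d\<close> says that the label of the angle \<open>d\<close> is 1; \<open>d0\<close> is the angle of the outer face at
  \<open>s\<^sub>0\<close>.\<close>
locale labeled_map = quad_map V E rot black
  for V :: "'v set" and E rot black +
  fixes L :: "'v \<times> 'v \<Rightarrow> bool" and s0 s1 :: 'v and d0 :: "'v \<times> 'v"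
  assumes lab_phi: "d \<in> E \<Longrightarrow> L (phi rot d) = (L d \<noteq> black (fst d))"
    and s0_neq_s1: "s0 \<noteq> s1"
    and black_s0: "black s0" and black_s1: "black s1"
    and lab_s0: "\<lbrakk>d \<in> E; fst d = s0\<rbrakk> \<Longrightarrow> \<not> L d"
    and lab_s1: "\<lbrakk>d \<in> E; fst d = s1\<rbrakk> \<Longrightarrow> L d"
    and fan0: "v \<in> V - {s0, s1} \<Longrightarrow> \<exists>d\<in>E. \<exists>m. fst d = v \<and> (\<forall>j\<le>m. \<not> L ((rot ^^ j) d)) \<and>
        L ((rot ^^ Suc m) d) \<and> {e \<in> E. fst e = v \<and> \<not> L e} = (\<lambda>j. (rot ^^ j) d) ` {..m}"
    and fan1: "v \<in> V - {s0, s1} \<Longrightarrow> \<exists>d\<in>E. \<exists>m. fst d = v \<and> (\<forall>j\<le>m. L ((rot ^^ j) d)) \<and>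
        \<not> L ((rot ^^ Suc m) d) \<and> {e \<in> E. fst e = v \<and> L e} = (\<lambda>j. (rot ^^ j) d) ` {..m}"
    and d0_in: "d0 \<in> E" and fst_d0: "fst d0 = s0"
    and fst_d1: "fst (phi rot (phi rot d0)) = s1"
begin

abbreviation inner :: "'v set" where "inner \<equiv> V - {s0, s1}"

text \<open>Under this symmetry the two trees are exchanged and the equator is traversed backwards.\<close>
lemma flip: "labeled_map V E rot black (\<lambda>d. \<not> L d) s1 s0 (phi rot (phi rot d0))"
proof unfold_locales
  show "d \<in> E \<Longrightarrow> (\<not> L (phi rot d)) = ((\<not> L d) \<noteq> black (fst d))" for d
    using lab_phi by auto
  show "v \<in> V - {s1, s0} \<Longrightarrow> \<exists>d\<in>E. \<exists>m. fst d = v \<and> (\<forall>j\<le>m. \<not> \<not> L ((rot ^^ j) d)) \<and>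
        \<not> L ((rot ^^ Suc m) d) \<and> {e \<in> E. fst e = v \<and> \<not> \<not> L e} = (\<lambda>j. (rot ^^ j) d) ` {..m}" for v
    using fan1[of v] by auto
  show "v \<in> V - {s1, s0} \<Longrightarrow> \<exists>d\<in>E. \<exists>m. fst d = v \<and> (\<forall>j\<le>m. \<not> L ((rot ^^ j) d)) \<and>
        \<not> \<not> L ((rot ^^ Suc m) d) \<and> {e \<in> E. fst e = v \<and> \<not> L e} = (\<lambda>j. (rot ^^ j) d) ` {..m}" for v
    using fan0[of v] by auto
  show "fst (phi rot (phi rot (phi rot (phi rot d0)))) = s0"
    using phi4'[OF d0_in] fst_d0 by simp
qed (use s0_neq_s1 black_s0 black_s1 lab_s0 lab_s1 d0_in fst_d1 phi_in in auto)

section \<open>Corners, label changes at inner vertices and arcs of colour 0\<close>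

lemma lab_rot_rv: "d \<in> E \<Longrightarrow> L (rot (rv d)) = (L d \<noteq> black (fst d))"
  using lab_phi by (simp add: phi_def)

lemma lab_rot: "d \<in> E \<Longrightarrow> L (rot d) = (L (rv d) \<noteq> black (snd d))"
  using lab_rot_rv[OF rv_in, of d] by simp

text \<open>The label changes exactly along darts with black tail, so the four corners of a face
  show each combination of colour and label once.\<close>

lemma corner_unique:
  assumes "z \<in> E" "z' \<in> E" "fc z = fc z'" "black (fst z) = black (fst z')" "L z = L z'"
  shows "z = z'"
proof -
  have "z' \<in> fc z"
    using assms in_fc by auto
  then show ?thesis
    using assms by (auto simp: fc_eq phi_in fst_phi lab_phi bipartite)
qed

text \<open>The labels on the two sides of \<open>d\<close> at its tail are \<open>L d\<close> and
  \<open>L (rot d)\<close>: this is where the labels, read counterclockwise around \<open>v\<close>,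
  rise from 0 to 1.\<close>

definition up :: "'v \<Rightarrow> 'v \<times> 'v" where
  "up v = (THE d. d \<in> E \<and> fst d = v \<and> \<not> L d \<and> L (rot d))"

definition dn :: "'v \<Rightarrow> 'v \<times> 'v" where
  "dn v = (THE d. d \<in> E \<and> fst d = v \<and> L d \<and> \<not> L (rot d))"

lemma up_ex1:
  assumes "v \<in> inner"
  shows "\<exists>!d. d \<in> E \<and> fst d = v \<and> \<not> L d \<and> L (rot d)"
proof -
  obtain d m where d: "d \<in> E" "fst d = v" "\<forall>j\<le>m. \<not> L ((rot ^^ j) d)" "L ((rot ^^ Suc m) d)"
    "{e \<in> E. fst e = v \<and> \<not> L e} = (\<lambda>j. (rot ^^ j) d) ` {..m}"
    using fan0[OF assms] by blast
  show ?thesis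
  proof
    show "(rot ^^ m) d \<in> E \<and> fst ((rot ^^ m) d) = v \<and> \<not> L ((rot ^^ m) d) \<and> L (rot ((rot ^^ m) d))"
      using d by (auto simp: rot_pow_in fst_rot_pow)
  next
    fix e assume e: "e \<in> E \<and> fst e = v \<and> \<not> L e \<and> L (rot e)"
    then have "e \<in> (\<lambda>j. (rot ^^ j) d) ` {..m}"
      using d(5) by blast
    then obtain j where j: "j \<le> m" "e = (rot ^^ j) d"
      by auto
    then have "\<not> Suc j \<le> m"
      using d(3) e by (metis comp_apply funpow.simps(2))
    then show "e = (rot ^^ m) d"
      using j by (simp add: le_antisym not_less_eq_eq)
  qed
qed

lemma up:
  assumes "v \<in> inner"
  shows "up v \<in> E" "fst (up v) = v" "\<not> L (up v)" "L (rot (up v))"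
  using theI'[OF up_ex1[OF assms]] by (simp_all add: up_def)

lemma up_eq: "d \<in> E \<Longrightarrow> \<not> L d \<Longrightarrow> L (rot d) \<Longrightarrow> fst d \<in> inner \<Longrightarrow> up (fst d) = d"
  using up_ex1[of "fst d"] up[of "fst d"] by blast

lemma dn_flip: "labeled_map.up E rot (\<lambda>d. \<not> L d) = dn"
  by (simp add: fun_eq_iff dn_def labeled_map.up_def[OF flip])

lemma up_flip: "labeled_map.dn E rot (\<lambda>d. \<not> L d) = up"
  by (simp add: fun_eq_iff up_def labeled_map.dn_def[OF flip])

lemma dn:
  assumes "v \<in> inner"
  shows "dn v \<in> E" "fst (dn v) = v" "L (dn v)" "\<not> L (rot (dn v))"
  using labeled_map.up[OF flip, of v] assms by (auto simp: dn_flip)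

lemma dn_eq: "d \<in> E \<Longrightarrow> L d \<Longrightarrow> \<not> L (rot d) \<Longrightarrow> fst d \<in> inner \<Longrightarrow> dn (fst d) = d"
  using labeled_map.up_eq[OF flip, of d] by (simp add: dn_flip insert_commute)

lemma inner_if:
  assumes "d \<in> E" "L d \<noteq> L (rot d)"
  shows "fst d \<in> inner"
  using assms lab_s0 lab_s1 rot_in fst_rot E_subset
  by (metis DiffI SigmaE fst_conv insertE singletonD subsetD)

text \<open>Such an edge has colour 0 and is oriented towards \<open>fst d\<close>, so
  \<open>d\<close> points from a parent to its child.\<close>

definition in0 :: "'v \<times> 'v \<Rightarrow> bool" where
  "in0 d \<longleftrightarrow> d \<in> E \<and> \<not> L d \<and> \<not> L (rot d)"

definition arcs :: "('v \<times> 'v) set" where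
  "arcs = {(c, p). in0 (p, c)}"

text \<open>The outgoing edge of colour 0. It is \<open>dn v\<close> or \<open>up v\<close> depending on the colour of \<open>v\<close>, since the
  label of the right face changes along the edge exactly when its tail is black.\<close>
definition out :: "'v \<Rightarrow> 'v \<times> 'v" where
  "out v = (if black v then dn v else up v)"

text \<open>The equator enters \<open>v\<close> from the face \<open>ent v\<close> and leaves to the face \<open>ext v\<close>.\<close>
definition ent :: "'v \<Rightarrow> ('v \<times> 'v) set" where
  "ent v = fc (if black v then up v else rot (up v))"

definition ext :: "'v \<Rightarrow> ('v \<times> 'v) set" where
  "ext v = fc (if black v then dn v else rot (dn v))"

lemma ext_flip: "labeled_map.ent E rot black (\<lambda>d. \<not> L d) = ext"
  by (simp add: fun_eq_iff ext_def labeled_map.ent_def[OF flip] dn_flip)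

lemma ent_flip: "labeled_map.ext E rot black (\<lambda>d. \<not> L d) = ent"
  by (simp add: fun_eq_iff ent_def labeled_map.ext_def[OF flip] up_flip)

text \<open>Two zeros at the head force, by the label rule, 1 then 0 at a black tail and 0 then 1 at
  a white one. Thus \<open>out c\<close> is the only candidate, and parents are unique.\<close>

lemma arcs_iff: "(c, p) \<in> arcs \<longleftrightarrow> c \<in> inner \<and> out c = (c, p)"
proof
  assume "(c, p) \<in> arcs"
  then have *: "(p, c) \<in> E" "\<not> L (p, c)" "\<not> L (rot (p, c))"
    by (auto simp: arcs_def in0_def)
  then have e: "(c, p) \<in> E" "black p = (\<not> black c)"
    using rv_in[of "(p, c)"] bipartite[of "(p, c)"] by auto
  have "L (rot (c, p)) = (\<not> black c)" "L (c, p) = black c"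
    using lab_rot_rv[of "(p, c)"] lab_rot_rv[of "(c, p)"] * e by auto
  moreover from this have "c \<in> inner"
    using inner_if[OF e(1)] by auto
  ultimately show "c \<in> inner \<and> out c = (c, p)"
    using e up_eq[of "(c, p)"] dn_eq[of "(c, p)"] by (auto simp: out_def)
next
  assume c: "c \<in> inner \<and> out c = (c, p)"
  then have "(c, p) \<in> E" "L (c, p) = black c" "L (rot (c, p)) = (\<not> black c)"
    using up[of c] dn[of c] by (auto simp: out_def split: if_splits)
  then show "(c, p) \<in> arcs"
    using lab_rot_rv[of "(p, c)"] lab_rot_rv[of "(c, p)"] rv_in[of "(c, p)"] bipartite[of "(c, p)"]
    by (auto simp: arcs_def in0_def)
qed

lemma out:
  assumes "v \<in> inner"
  shows "out v \<in> E" "fst (out v) = v" "(v, snd (out v)) \<in> arcs"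
proof -
  show *: "out v \<in> E" "fst (out v) = v"
    using up[OF assms] dn[OF assms] by (auto simp: out_def)
  then show "(v, snd (out v)) \<in> arcs"
    using assms arcs_iff[of v "snd (out v)"] by (metis prod.collapse)
qed

lemma arcs_functional: "(c, p) \<in> arcs \<Longrightarrow> (c, q) \<in> arcs \<Longrightarrow> p = q"
  by (auto simp: arcs_iff)

text \<open>Translates the two faces at an arc from the view of the child to that of the parent, so
  that the walk around the child fits into the one around the parent.\<close>

lemma in0_child:
  assumes "in0 d"
  shows "(snd d, fst d) \<in> arcs" "out (snd d) = rv d" "fc (rot (out (snd d))) = fc d"
    "fc (out (snd d)) = fc (rot d)"
proof -
  show a: "(snd d, fst d) \<in> arcs"
    using assms by (auto simp: arcs_def)
  then show o: "out (snd d) = rv d"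
    by (simp add: arcs_iff)
  have "d \<in> E" using assms by (simp add: in0_def)
  then show "fc (rot (out (snd d))) = fc d" "fc (out (snd d)) = fc (rot d)"
    by (simp_all add: o fc_rot_rv fc_rot)
qed

text \<open>A face has a single black corner labelled 0. In \<open>ent x\<close> it is at the tail
  of \<open>up x\<close> if \<open>x\<close> is black and at the head if \<open>x\<close> is white;
  the label across that edge tells the two cases apart.\<close>

lemma ent_inj:
  assumes "u \<in> inner" "v \<in> inner" "ent u = ent v"
  shows "u = v"
proof -
  define z where "z x = (if black x then up x else rv (up x))" for x
  have z: "z x \<in> E \<and> fc (z x) = ent x \<and> black (fst (z x)) \<and> \<not> L (z x)
      \<and> L (rot (z x)) = black x \<and> x = (if black x then fst (z x) else snd (z x))"
    if x: "x \<in> inner" for x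
  proof (cases "black x")
    case True
    then show ?thesis
      using up[OF x] by (simp add: z_def ent_def)
  next
    case False
    then show ?thesis
      using up[OF x] rv_in[OF up(1)[OF x]] bipartite[OF up(1)[OF x]] fc_rot[OF up(1)[OF x]]
        lab_rot_rv[OF up(1)[OF x]] lab_rot[OF up(1)[OF x]]
      by (simp add: z_def ent_def)
  qed
  have "z u = z v"
    using z[OF assms(1)] z[OF assms(2)] assms(3) corner_unique[of "z u" "z v"] by simp
  then show ?thesis
    using z[OF assms(1)] z[OF assms(2)] by metis
qed

text \<open>The zeros at \<open>v\<close> begin right after \<open>dn v\<close> and end at
  \<open>up v\<close>. Every dart of this fan but the last has zeros on both sides, so these darts
  are the children in rotation order.\<close>

lemma fan0_walk:
  assumes v: "v \<in> inner"
  shows "\<exists>m. (rot ^^ m) (rot (dn v)) = up v \<and>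
    {d. in0 d \<and> fst d = v} = (\<lambda>j. (rot ^^ j) (rot (dn v))) ` {..<m} \<and>
    inj_on (\<lambda>j. (rot ^^ j) (rot (dn v))) {..<m}"
proof -
  obtain d m where d: "d \<in> E" "fst d = v" "\<forall>j\<le>m. \<not> L ((rot ^^ j) d)" "L ((rot ^^ Suc m) d)"
    "{e \<in> E. fst e = v \<and> \<not> L e} = (\<lambda>j. (rot ^^ j) d) ` {..m}"
    using fan0[OF v] by blast
  have "rot (dn v) \<in> {e \<in> E. fst e = v \<and> \<not> L e}"
    using dn[OF v] by (simp add: rot_in fst_rot)
  then obtain j where j: "j \<le> m" "rot (dn v) = (rot ^^ j) d"
    unfolding d(5) by auto
  \<comment> \<open>If the fan began before \<open>rot (dn v)\<close>, it would contain
    \<open>dn v\<close>, whose label is 1.\<close>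
  have "j = 0"
  proof (rule ccontr)
    assume "j \<noteq> 0"
    then obtain i where i: "j = Suc i" by (cases j) auto
    then have "dn v = (rot ^^ i) d"
      using j inj_onD[OF inj_rot] d(1) dn[OF v] by (simp add: rot_pow_in)
    then show False
      using d(3) i j dn(3)[OF v] by auto
  qed
  then have f: "rot (dn v) = d" using j by simp
  have "up v = (rot ^^ m) d"
    using up_eq[of "(rot ^^ m) d"] d v by (simp add: rot_pow_in fst_rot_pow)
  moreover have "{d. in0 d \<and> fst d = v} = (\<lambda>j. (rot ^^ j) d) ` {..<m}"
  proof
    show "{d. in0 d \<and> fst d = v} \<subseteq> (\<lambda>j. (rot ^^ j) d) ` {..<m}"
    proof
      fix e assume e: "e \<in> {d. in0 d \<and> fst d = v}"
      then have "e \<in> (\<lambda>j. (rot ^^ j) d) ` {..m}"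
        unfolding d(5)[symmetric] by (auto simp: in0_def)
      then obtain i where i: "i \<le> m" "e = (rot ^^ i) d" by auto
      then have "i \<noteq> m"
        using e d(4) by (auto simp: in0_def)
      then show "e \<in> (\<lambda>j. (rot ^^ j) d) ` {..<m}"
        using i by auto
    qed
    have "in0 ((rot ^^ i) d)" if "i < m" for i
    proof -
      have "\<not> L ((rot ^^ i) d)" "\<not> L ((rot ^^ Suc i) d)"
        using d(3) that by (meson Suc_leI less_imp_le)+
      then show ?thesis
        using d(1) by (simp add: in0_def rot_pow_in)
    qed
    then show "(\<lambda>j. (rot ^^ j) d) ` {..<m} \<subseteq> {d. in0 d \<and> fst d = v}"
      using d(1,2) by (auto simp: fst_rot_pow)
  qed
  moreover have "inj_on (\<lambda>j. (rot ^^ j) d) {..<m}"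
  proof (rule linorder_inj_onI)
    fix i j assume ij: "i < j" "i \<in> {..<m}" "j \<in> {..<m}"
    show "(rot ^^ i) d \<noteq> (rot ^^ j) d"
    proof
      assume "(rot ^^ i) d = (rot ^^ j) d"
      then have "(rot ^^ (j - i)) d = d"
        using rot_pow_cancel[OF d(1)] ij by simp
      \<comment> \<open>A repetition would identify the dart just after the fan, labelled 1, with
        one inside it.\<close>
      then have "(rot ^^ (Suc m - (j - i))) d = (rot ^^ Suc m) d"
        using funpow_add[of "Suc m - (j - i)" "j - i" rot] ij by simp
      moreover have "\<not> L ((rot ^^ (Suc m - (j - i))) d)"
        using d(3) ij by simp
      ultimately show False
        using d(4) by simp
    qed
  qed auto
  ultimately show ?thesis
    using f by auto
qed

section \<open>Subtrees as contiguous runs of the equator\<close>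

definition desc :: "'v \<Rightarrow> 'v set" where
  "desc c = {x. (x, c) \<in> arcs\<^sup>*}"

lemma s0_no_arc: "(s0, p) \<notin> arcs"
  by (simp add: arcs_iff)

text \<open>Parents are unique, so a cycle through \<open>c\<close> would contain everything
  reachable from \<open>c\<close>, including \<open>s0\<close>, which has no parent.\<close>

lemma arcs_acyclic:
  assumes "(c, s0) \<in> arcs\<^sup>*"
  shows "(c, c) \<notin> arcs\<^sup>+"
proof
  assume c: "(c, c) \<in> arcs\<^sup>+"
  have "(x, x) \<in> arcs\<^sup>+" if "(c, x) \<in> arcs\<^sup>*" for x
    using that
  proof induction
    case (step x y)
    then obtain z where z: "(x, z) \<in> arcs" "(z, x) \<in> arcs\<^sup>*"
      by (meson tranclD)
    then have "z = y"
      using step.hyps arcs_functional by blast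
    then show ?case
      using z step.hyps by (metis rtrancl_into_trancl1)
  qed (rule c)
  then have "(s0, s0) \<in> arcs\<^sup>+"
    using assms by blast
  then show False
    using s0_no_arc by (meson tranclD)
qed

text \<open>A nontrivial path from \<open>x\<close> starts with the arc to \<open>p\<close>, so
  reaching \<open>y\<close> would close a cycle at \<open>p\<close>.\<close>

lemma siblings_incomparable:
  assumes "(x, p) \<in> arcs" "(y, p) \<in> arcs" "x \<noteq> y" "(p, s0) \<in> arcs\<^sup>*"
  shows "(x, y) \<notin> arcs\<^sup>*"
proof
  assume "(x, y) \<in> arcs\<^sup>*"
  then show False
  proof (cases rule: converse_rtranclE)
    case base
    then show ?thesis using assms(3) by simp
  next
    case (step q)
    then have "(p, y) \<in> arcs\<^sup>*"
      using arcs_functional[OF assms(1) step(1)] by simp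
    then have "(p, p) \<in> arcs\<^sup>+"
      using assms(2) by (rule rtrancl_into_trancl1)
    then show ?thesis
      using arcs_acyclic[OF assms(4)] by simp
  qed
qed

text \<open>The ancestors of a common descendant form a chain, which cannot contain two distinct
  siblings.\<close>

lemma desc_disjoint:
  assumes "in0 d" "in0 d'" "fst d = fst d'" "(fst d, s0) \<in> arcs\<^sup>*" "d \<noteq> d'"
  shows "desc (snd d) \<inter> desc (snd d') = {}"
proof (rule ccontr)
  assume "desc (snd d) \<inter> desc (snd d') \<noteq> {}"
  then obtain x where x: "(x, snd d) \<in> arcs\<^sup>*" "(x, snd d') \<in> arcs\<^sup>*"
    by (auto simp only: desc_def mem_Collect_eq Int_iff)
  have "single_valued arcs"
    using arcs_functional by (auto simp: single_valued_def)
  then have "(snd d, snd d') \<in> arcs\<^sup>* \<or> (snd d', snd d) \<in> arcs\<^sup>*"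
    using x by (rule single_valued_confluent)
  moreover have "(snd d, fst d) \<in> arcs" "(snd d', fst d) \<in> arcs" "snd d \<noteq> snd d'"
    using in0_child(1)[OF assms(1)] in0_child(1)[OF assms(2)] assms(3,5) by (auto simp: prod_eq_iff)
  ultimately show False
    using siblings_incomparable assms(4) by metis
qed

lemma desc_unfold: "desc c = insert c (\<Union>d\<in>{d. in0 d \<and> fst d = c}. desc (snd d))"
proof (intro set_eqI iffI)
  fix x assume "x \<in> desc c"
  then have "(x, c) \<in> arcs\<^sup>*" by (simp add: desc_def)
  then show "x \<in> insert c (\<Union>d\<in>{d. in0 d \<and> fst d = c}. desc (snd d))"
  proof (cases rule: rtranclE)
    case (step y)
    then have "in0 (c, y)" "x \<in> desc (snd (c, y))"
      by (simp_all add: arcs_def desc_def)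
    then show ?thesis
      by (metis (mono_tags, lifting) UN_I fst_conv insertI2 mem_Collect_eq)
  qed simp
next
  fix x assume "x \<in> insert c (\<Union>d\<in>{d. in0 d \<and> fst d = c}. desc (snd d))"
  then consider "x = c" | d where "in0 d" "fst d = c" "x \<in> desc (snd d)"
    by auto
  then show "x \<in> desc c"
  proof cases
    case (2 d)
    then show ?thesis
      using in0_child(1)[OF 2(1)] by (simp add: desc_def)
  qed (simp add: desc_def)
qed

lemma not_in_child_desc:
  assumes "in0 d" "(fst d, s0) \<in> arcs\<^sup>*"
  shows "fst d \<notin> desc (snd d)"
proof
  assume "fst d \<in> desc (snd d)"
  then have "(fst d, snd d) \<in> arcs\<^sup>*"
    by (simp only: desc_def mem_Collect_eq)
  then show False
    using rtrancl_into_trancl1[OF _ in0_child(1)[OF assms(1)]] arcs_acyclic[OF assms(2)] by blast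
qed

lemma desc_inner:
  assumes "c \<in> inner"
  shows "desc c \<subseteq> inner"
proof
  fix x assume "x \<in> desc c"
  then have "(x, c) \<in> arcs\<^sup>*" by (simp add: desc_def)
  then show "x \<in> inner"
    by (cases rule: converse_rtranclE) (use assms in \<open>simp_all add: arcs_iff\<close>)
qed

text \<open>The walk starts in the face to the left of the arc leaving \<open>c\<close> and ends in
  the face to its right.\<close>

definition block :: "'v \<Rightarrow> 'v list \<Rightarrow> bool" where
  "block c bs \<longleftrightarrow> run ent ext (fc (rot (out c))) bs (fc (out c)) \<and> set bs = desc c \<and>
     (if black c then last bs = c else hd bs = c)"

definition blocks :: "'v list \<Rightarrow> bool" where
  "blocks ys \<longleftrightarrow> (\<forall>x\<in>set ys. \<exists>as bs cs. ys = as @ bs @ cs \<and> block x bs)"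

lemma blocks_append:
  assumes "blocks xs" "blocks ys"
  shows "blocks (xs @ ys)"
  unfolding blocks_def
proof
  fix x assume "x \<in> set (xs @ ys)"
  then consider "x \<in> set xs" | "x \<in> set ys" by auto
  then show "\<exists>as bs cs. xs @ ys = as @ bs @ cs \<and> block x bs"
  proof cases
    case 1
    then show ?thesis
      using assms(1) unfolding blocks_def by (metis append.assoc)
  next
    case 2
    then show ?thesis
      using assms(2) unfolding blocks_def by (metis append.assoc)
  qed
qed

text \<open>The block of the child at \<open>d\<close> ends in \<open>fc (rot d)\<close>, where the
  block of the next child begins. Start and length are free, to serve both an inner vertex, from
  \<open>rot (dn c)\<close> to \<open>up c\<close>, and the root, once around.\<close>

lemma children_run:
  assumes c: "(c, s0) \<in> arcs\<^sup>*" and f: "f \<in> E"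
    and sub: "\<And>d. in0 d \<Longrightarrow> fst d = c \<Longrightarrow> \<exists>ys. block (snd d) ys \<and> distinct ys \<and> blocks ys"
    and walk: "(\<lambda>j. (rot ^^ j) f) ` {..<m} \<subseteq> {d. in0 d \<and> fst d = c}"
    and inj: "inj_on (\<lambda>j. (rot ^^ j) f) {..<m}"
  shows "\<exists>ys. run ent ext (fc f) ys (fc ((rot ^^ m) f)) \<and> distinct ys \<and> blocks ys \<and>
    set ys = (\<Union>d\<in>(\<lambda>j. (rot ^^ j) f) ` {..<m}. desc (snd d))"
  using walk inj
proof (induction m)
  case 0
  then show ?case
    by (intro exI[of _ "[]"]) (simp add: blocks_def)
next
  case (Suc m)
  let ?d = "(rot ^^ m) f"
  let ?D = "(\<lambda>j. (rot ^^ j) f) ` {..<m}"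
  have D: "?D \<subseteq> {d. in0 d \<and> fst d = c}" "inj_on (\<lambda>j. (rot ^^ j) f) {..<m}"
    using Suc.prems by (auto simp: lessThan_Suc)
  obtain xs where xs: "run ent ext (fc f) xs (fc ?d)" "distinct xs" "blocks xs"
    "set xs = (\<Union>d\<in>?D. desc (snd d))"
    using Suc.IH[OF D] by blast
  have d: "in0 ?d" "fst ?d = c"
    using Suc.prems by auto
  obtain ys where ys: "block (snd ?d) ys" "distinct ys" "blocks ys"
    using sub[OF d] by blast
  have "?d \<notin> ?D"
    using Suc.prems(2) by (auto simp: lessThan_Suc inj_on_def)
  then have "set xs \<inter> set ys = {}"
  proof -
    have "desc (snd e) \<inter> desc (snd ?d) = {}" if "e \<in> ?D" for e
    proof (rule desc_disjoint)
      show "in0 e" "fst e = fst ?d" "(fst e, s0) \<in> arcs\<^sup>*" "in0 ?d"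
        using D(1) that d c by auto
      show "e \<noteq> ?d"
        using \<open>?d \<notin> ?D\<close> that by metis
    qed
    moreover have "set ys = desc (snd ?d)"
      using ys(1) by (simp only: block_def)
    ultimately show ?thesis
      unfolding xs(4) by blast
  qed
  moreover have "run ent ext (fc f) (xs @ ys) (fc (rot ?d))"
    using xs(1) ys(1) in0_child[OF d(1)] by (auto simp: run_append block_def)
  ultimately show ?case
    using xs ys blocks_append[OF xs(3) ys(3)]
    by (intro exI[of _ "xs @ ys"]) (auto simp: lessThan_Suc block_def)
qed

lemma finite_desc: "c \<in> inner \<Longrightarrow> finite (desc c)"
  using desc_inner finite_V by (meson finite_Diff finite_subset)

lemma subtree_run:
  assumes "c \<in> inner" "(c, s0) \<in> arcs\<^sup>*"
  shows "\<exists>ys. block c ys \<and> distinct ys \<and> blocks ys"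
  using assms
proof (induction "card (desc c)" arbitrary: c rule: less_induct)
  case less
  note c = less.prems
  have "\<exists>ys. block (snd d) ys \<and> distinct ys \<and> blocks ys" if d: "in0 d" "fst d = c" for d
  proof (rule less.hyps)
    have arc: "(snd d, c) \<in> arcs"
      using in0_child(1)[OF d(1)] d(2) by simp
    \<comment> \<open>Acyclicity makes the subtree of a child strictly smaller.\<close>
    have "c \<notin> desc (snd d)"
      using not_in_child_desc d c by blast
    moreover have "desc (snd d) \<subseteq> desc c" "c \<in> desc c"
      using d desc_unfold[of c] by auto
    ultimately show "card (desc (snd d)) < card (desc c)"
      using finite_desc[OF c(1)] by (intro psubset_card_mono) auto
    show "snd d \<in> inner"
      using arc by (simp add: arcs_iff)
    show "(snd d, s0) \<in> arcs\<^sup>*"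
      using arc c(2) by simp
  qed
  note sub = this
  obtain m where m: "(rot ^^ m) (rot (dn c)) = up c"
    "{d. in0 d \<and> fst d = c} = (\<lambda>j. (rot ^^ j) (rot (dn c))) ` {..<m}"
    "inj_on (\<lambda>j. (rot ^^ j) (rot (dn c))) {..<m}"
    using fan0_walk[OF c(1)] by blast
  obtain ys where ys: "run ent ext (fc (rot (dn c))) ys (fc (up c))" "distinct ys" "blocks ys"
    "set ys = (\<Union>d\<in>{d. in0 d \<and> fst d = c}. desc (snd d))"
    using children_run[OF c(2) rot_in[OF dn(1)[OF c(1)]] sub equalityD2[OF m(2)] m(3)]
    unfolding m(1) m(2)[symmetric] by blast
  have "c \<notin> set ys"
    using ys(4) not_in_child_desc c(2) by auto
  \<comment> \<open>The run of the children leads from \<open>fc (rot (dn c))\<close> to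
    \<open>fc (up c)\<close>. A black \<open>c\<close> is entered from the latter face, a white
    \<open>c\<close> leaves to the former.\<close>
  define zs where "zs = (if black c then ys @ [c] else c # ys)"
  have zs: "distinct zs" "set zs = desc c"
    using ys \<open>c \<notin> set ys\<close> desc_unfold[of c] by (auto simp: zs_def)
  have b: "block c zs"
    using ys(1) zs unfolding block_def
    by (auto simp: zs_def run_append ent_def ext_def out_def)
  have "\<exists>as bs cs. zs = as @ bs @ cs \<and> block x bs" if x: "x \<in> set zs" for x
  proof (cases "x = c")
    case True
    then show ?thesis
      using b by (metis append_Nil append_Nil2)
  next
    case False
    then have "x \<in> set ys"
      using x by (auto simp: zs_def split: if_splits)
    then obtain as bs cs where "ys = as @ bs @ cs" "block x bs"
      using ys(3) by (auto simp: blocks_def)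
    moreover from this have "zs = as @ bs @ (cs @ [c]) \<or> zs = (c # as) @ bs @ cs"
      by (auto simp: zs_def)
    ultimately show ?thesis by blast
  qed
  then have "blocks zs" by (simp add: blocks_def)
  then show ?case
    using b zs by blast
qed

lemma root_walk:
  "\<exists>m. (rot ^^ m) d0 = d0 \<and> {d. in0 d \<and> fst d = s0} = (\<lambda>j. (rot ^^ j) d0) ` {..<m} \<and>
    inj_on (\<lambda>j. (rot ^^ j) d0) {..<m}"
proof -
  have eq: "{d. in0 d \<and> fst d = s0} = darts_at E (fst d0)"
    using fst_d0 by (auto simp: darts_at_def in0_def lab_s0 rot_in fst_rot)
  show ?thesis
    unfolding eq using rot_cycle[OF d0_in] by (rule exI)
qed

text \<open>At \<open>s0\<close> every dart leads to a child, so the walk around \<open>s0\<close>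
  closes up in the outer face. So far it is only known to meet the component of
  \<open>s0\<close>.\<close>

lemma root_run:
  "\<exists>vs. run ent ext (fc d0) vs (fc d0) \<and> distinct vs \<and> blocks vs \<and> set vs = desc s0 - {s0} \<and> vs \<noteq> []"
proof -
  obtain m where m: "(rot ^^ m) d0 = d0"
    "{d. in0 d \<and> fst d = s0} = (\<lambda>j. (rot ^^ j) d0) ` {..<m}"
    "inj_on (\<lambda>j. (rot ^^ j) d0) {..<m}"
    using root_walk by blast
  have sub: "\<exists>ys. block (snd d) ys \<and> distinct ys \<and> blocks ys" if d: "in0 d" "fst d = s0" for d
    using in0_child(1)[OF d(1)] d(2) by (intro subtree_run) (auto simp: arcs_iff)
  obtain ys where ys: "run ent ext (fc d0) ys (fc d0)" "distinct ys" "blocks ys"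
    "set ys = (\<Union>d\<in>{d. in0 d \<and> fst d = s0}. desc (snd d))"
    using children_run[OF _ d0_in sub equalityD2[OF m(2)] m(3)]
    unfolding m(1) m(2)[symmetric] by blast
  have "s0 \<notin> set ys"
    using ys(4) not_in_child_desc by fastforce
  then have "set ys = desc s0 - {s0}"
    using ys(4) desc_unfold[of s0] by auto
  have "in0 d0"
    using d0_in fst_d0 lab_s0 by (simp add: in0_def rot_in fst_rot)
  moreover have "snd d0 \<in> desc (snd d0)"
    by (simp add: desc_def)
  ultimately have "snd d0 \<in> set ys"
    unfolding ys(4) using fst_d0 by blast
  then have "ys \<noteq> []"
    by auto
  with \<open>set ys = desc s0 - {s0}\<close> show ?thesis
    using ys by blast
qed

section \<open>Colours of edges and faces around a vertex\<close>

lemma in0_flip: "labeled_map.in0 E rot (\<lambda>d. \<not> L d) d \<longleftrightarrow> d \<in> E \<and> L d \<and> L (rot d)"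
  by (simp add: labeled_map.in0_def[OF flip])

text \<open>The ends of an edge differ in colour, so by the label rule the two labels agree at
  exactly one end; that end gives the orientation and its label the colour.\<close>

lemma edge_arcs:
  assumes "(x, y) \<in> E"
  shows "(y, x) \<in> arcs \<or> (x, y) \<in> arcs \<or>
    (y, x) \<in> labeled_map.arcs E rot (\<lambda>d. \<not> L d) \<or> (x, y) \<in> labeled_map.arcs E rot (\<lambda>d. \<not> L d)"
  using assms rv_in[OF assms] lab_rot[OF assms] lab_rot_rv[OF assms] bipartite[OF assms]
  by (auto simp: arcs_def labeled_map.arcs_def[OF flip] in0_def in0_flip)

lemma arcs_exclusive:
  assumes "(c, p) \<in> arcs"
  shows "(p, c) \<notin> arcs" "(c, p) \<notin> labeled_map.arcs E rot (\<lambda>d. \<not> L d)"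
    "(p, c) \<notin> labeled_map.arcs E rot (\<lambda>d. \<not> L d)"
  using assms lab_rot[of "(p, c)"] lab_rot_rv[of "(p, c)"] bipartite[of "(p, c)"]
  by (auto simp: arcs_def labeled_map.arcs_def[OF flip] in0_def in0_flip)

lemma arcs_desc_root:
  assumes "(c, p) \<in> arcs"
  shows "c \<in> desc s0 \<longleftrightarrow> p \<in> desc s0"
proof
  assume "c \<in> desc s0"
  then have "(c, s0) \<in> arcs\<^sup>*"
    by (simp only: desc_def mem_Collect_eq)
  then show "p \<in> desc s0"
  proof (cases rule: converse_rtranclE)
    case (step y)
    then show ?thesis
      using arcs_functional[OF assms step(1)] by (simp only: desc_def mem_Collect_eq)
  qed (use assms s0_no_arc in simp)
next
  assume "p \<in> desc s0"
  then show "c \<in> desc s0"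
    unfolding desc_def mem_Collect_eq using assms by (rule converse_rtrancl_into_rtrancl[rotated])
qed

lemma s1_no_in_arc: "(c, s1) \<notin> arcs"
  using lab_s1 by (auto simp: arcs_def in0_def)

lemma desc_refl: "c \<in> desc c"
  by (simp add: desc_def)

lemma desc_root_subset: "desc s0 \<subseteq> insert s0 inner"
proof
  fix x assume "x \<in> desc s0"
  then have "(x, s0) \<in> arcs\<^sup>*"
    by (simp only: desc_def mem_Collect_eq)
  then show "x \<in> insert s0 inner"
    by (cases rule: converse_rtranclE) (simp_all add: arcs_iff)
qed

lemma s0_in: "s0 \<in> V"
  using d0_in fst_d0 E_subset by force

text \<open>Consecutive faces of the fan are separated by the edge to a child. The relation
  \<open>R\<close> is later instantiated by \<open>adj\<close>.\<close>

lemma fan_connected: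
  assumes "v \<in> inner" and R: "\<And>d. in0 d \<Longrightarrow> fst d = v \<Longrightarrow> (fc d, fc (rot d)) \<in> R"
  shows "(fc (rot (dn v)), fc (up v)) \<in> R\<^sup>*"
proof -
  obtain m where m: "(rot ^^ m) (rot (dn v)) = up v"
    "{d. in0 d \<and> fst d = v} = (\<lambda>j. (rot ^^ j) (rot (dn v))) ` {..<m}"
    using fan0_walk[OF assms(1)] by blast
  have "(fc (rot (dn v)), fc ((rot ^^ j) (rot (dn v)))) \<in> R\<^sup>*" if "j \<le> m" for j
    using that
  proof (induction j)
    case (Suc j)
    then have "(rot ^^ j) (rot (dn v)) \<in> {d. in0 d \<and> fst d = v}"
      unfolding m(2) by auto
    then have "(fc ((rot ^^ j) (rot (dn v))), fc (rot ((rot ^^ j) (rot (dn v))))) \<in> R"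
      using R by blast
    then show ?case
      using Suc by (simp add: rtrancl_into_rtrancl)
  qed simp
  then show ?thesis
    using m(1) by (metis order_refl)
qed

text \<open>One turns around \<open>v\<close> through its corners labelled 0 and across its outgoing
  edge of colour 0. All edges crossed have colour 0.\<close>

lemma ent_ext_connected:
  assumes v: "v \<in> inner" and R: "\<And>d. in0 d \<Longrightarrow> fst d = v \<Longrightarrow> (fc d, fc (rot d)) \<in> R"
    and out: "(fc (out v), fc (rot (out v))) \<in> R" and "sym R"
  shows "(ent v, ext v) \<in> R\<^sup>*"
proof -
  have sym: "(G, F) \<in> R\<^sup>*" if "(F, G) \<in> R\<^sup>*" for F G
    using that sym_rtrancl[OF assms(4)] by (meson symD)
  have fan: "(fc (up v), fc (rot (dn v))) \<in> R\<^sup>*"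
    using sym fan_connected[OF v R] by blast
  have out': "(fc (rot (out v)), fc (out v)) \<in> R\<^sup>*"
    using sym r_into_rtrancl[OF out] by blast
  show ?thesis
  proof (cases "black v")
    case True
    then show ?thesis
      using rtrancl_trans[OF fan] out' by (simp add: ent_def ext_def out_def)
  next
    case False
    then show ?thesis
      using rtrancl_trans[OF _ fan] out' by (simp add: ent_def ext_def out_def)
  qed
qed

text \<open>The inner vertices on the outer face are at the white corners \<open>phi rot d0\<close>,
  labelled 1, and its opposite, labelled 0. The equator enters from the outer face at the
  former.\<close>

lemma outer_white_corner:
  assumes "d \<in> E" "fc d = fc d0" "fst d \<in> inner" "L d"
  shows "ent (fst d) = fc d0"
proof -
  let ?p = "phi rot"
  have "d \<in> {d0, ?p d0, ?p (?p d0), ?p (?p (?p d0))}"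
    using in_fc[OF assms(1)] assms(2) fc_eq[OF d0_in] by simp
  moreover have "d \<noteq> d0" "d \<noteq> ?p (?p d0)"
    using assms(3) fst_d0 fst_d1 by auto
  moreover have "\<not> L d0" "black (fst d0)"
    using lab_s0 d0_in fst_d0 black_s0 by auto
  then have "\<not> L (?p (?p (?p d0)))" "L (?p d0)" "\<not> black (fst (?p d0))"
    using d0_in by (auto simp: lab_phi phi_in fst_phi bipartite)
  ultimately have d: "d = ?p d0" "\<not> black (fst d)"
    using assms(4) by auto
  have e: "rv d0 \<in> E" "rot (rv d0) = d" "fst (rv d0) = fst d"
    using rv_in[OF d0_in] d fst_phi[OF d0_in] by (simp_all add: phi_def)
  have "\<not> L (rot d0)"
    using lab_s0 d0_in fst_d0 by (simp add: rot_in fst_rot)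
  then have "\<not> L (rv d0)"
    using lab_rot[OF d0_in] d fst_phi[OF d0_in] by simp
  then have "up (fst d) = rv d0"
    using up_eq[OF e(1)] e assms(3,4) by simp
  then show ?thesis
    using d e assms(2) by (simp add: ent_def)
qed

text \<open>The darts of \<open>P\<^sub>0(v) \<union> P\<^sub>1(v)\<close>.\<close>
definition pathd :: "'v \<Rightarrow> ('v \<times> 'v) set" where
  "pathd v = (let P = {(x, y) \<in> arcs. (v, x) \<in> arcs\<^sup>*} \<union>
     {(x, y) \<in> labeled_map.arcs E rot (\<lambda>d. \<not> L d). (v, x) \<in> (labeled_map.arcs E rot (\<lambda>d. \<not> L d))\<^sup>*}
   in {(x, y). (x, y) \<in> P \<or> (y, x) \<in> P})"

section \<open>Moves between bounded faces that avoid both paths\<close>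

definition bounded :: "('v \<times> 'v) set set" where
  "bounded = fc ` E - {fc d0}"

definition adj :: "'v \<Rightarrow> (('v \<times> 'v) set \<times> ('v \<times> 'v) set) set" where
  "adj v = {(F, G). F \<in> bounded \<and> G \<in> bounded \<and> (\<exists>d\<in>F. d \<notin> pathd v \<and> rv d \<in> G)}"

lemma pathd_flip: "labeled_map.pathd E rot (\<lambda>d. \<not> L d) = pathd"
  by (simp add: fun_eq_iff pathd_def labeled_map.pathd_def[OF flip] Un_commute)

lemma fc_d1: "fc (phi rot (phi rot d0)) = fc d0"
  by (simp add: fc_phi phi_in d0_in)

lemma adj_flip: "labeled_map.adj E rot (\<lambda>d. \<not> L d) (phi rot (phi rot d0)) = adj"
  by (simp add: fun_eq_iff adj_def labeled_map.adj_def[OF flip] bounded_def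
      labeled_map.bounded_def[OF flip] pathd_flip fc_d1)

text \<open>\<open>P\<^sub>0(v)\<close> consists of the arcs leaving \<open>v\<close> and its
  ancestors, and an arc of colour 0 cannot lie on \<open>P\<^sub>1(v)\<close>.\<close>

lemma pathd_arc:
  assumes "(c, p) \<in> arcs"
  shows "(c, p) \<in> pathd v \<longleftrightarrow> v \<in> desc c" "(p, c) \<in> pathd v \<longleftrightarrow> v \<in> desc c"
  using assms arcs_exclusive[OF assms] by (simp_all add: pathd_def desc_def)

lemma pathd_sym: "rv d \<in> pathd v \<longleftrightarrow> d \<in> pathd v"
  by (cases d) (auto simp: pathd_def)

lemma sym_adj: "sym (adj v)"
proof (rule symI)
  fix F G assume "(F, G) \<in> adj v"
  then obtain d where d: "F \<in> bounded" "G \<in> bounded" "d \<in> F" "d \<notin> pathd v" "rv d \<in> G"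
    unfolding adj_def by blast
  then have "rv d \<notin> pathd v" "rv (rv d) \<in> F"
    by (simp_all only: pathd_sym fst_conv snd_conv prod.collapse not_False_eq_True)
  then show "(G, F) \<in> adj v"
    using d unfolding adj_def by blast
qed

lemma adj_step:
  assumes "d \<in> E" "fc d \<noteq> fc d0" "fc (rot d) \<noteq> fc d0" "d \<notin> pathd v"
  shows "(fc d, fc (rot d)) \<in> adj v"
proof -
  have "fc d \<in> bounded" "fc (rot d) \<in> bounded"
    using assms by (auto simp: bounded_def rot_in)
  moreover have "rv d \<in> fc (rot d)"
    using in_fc[OF rv_in[OF assms(1)]] fc_rot[OF assms(1)] by simp
  ultimately show ?thesis
    using in_fc[OF assms(1)] assms(4) unfolding adj_def by blast
qed

text \<open>Contrapositive of \<open>outer_white_corner\<close>; exchanging the labels turns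
  \<open>ent\<close> into \<open>ext\<close> and covers label 0.\<close>

lemma corner_bounded:
  assumes "d \<in> E" "fst d \<in> inner"
  shows "L d \<Longrightarrow> ent (fst d) \<noteq> fc d0 \<Longrightarrow> fc d \<noteq> fc d0"
    "\<not> L d \<Longrightarrow> ext (fst d) \<noteq> fc d0 \<Longrightarrow> fc d \<noteq> fc d0"
  using outer_white_corner[of d] labeled_map.outer_white_corner[OF flip, of d] assms
  by (auto simp: ext_flip fc_d1)

text \<open>Turning around \<open>u\<close> on its side labelled 0 crosses only the arcs leaving
  \<open>u\<close> and its children. As \<open>v\<close> is not below \<open>u\<close>, none of them
  is on the two paths.\<close>

lemma ent_ext_adj:
  assumes u: "u \<in> inner" and b: "ent u \<noteq> fc d0" "ext u \<noteq> fc d0" and v: "v \<notin> desc u"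
  shows "(ent u, ext u) \<in> (adj v)\<^sup>*"
proof (rule ent_ext_connected[OF u _ _ sym_adj])
  have bd: "fc d \<noteq> fc d0" if "d \<in> E" "fst d = u" for d
    using corner_bounded[of d] that u b by blast
  have step: "(fc d, fc (rot d)) \<in> adj v" if "d \<in> E" "fst d = u" "d \<notin> pathd v" for d
    using that bd[of d] bd[of "rot d"] by (intro adj_step) (simp_all add: rot_in fst_rot)
  show "(fc d, fc (rot d)) \<in> adj v" if d: "in0 d" "fst d = u" for d
  proof (rule step)
    show "d \<in> E" using d by (simp add: in0_def)
    have "v \<notin> desc (snd d)"
      using v d desc_unfold[of u] by blast
    then show "d \<notin> pathd v"
      using pathd_arc(2)[OF in0_child(1)[OF d(1)]] by simp
  qed (rule d(2))
  show "(fc (out u), fc (rot (out u))) \<in> adj v"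
  proof (rule step)
    have "out u = (u, snd (out u))"
      using out(2)[OF u] by (simp add: prod_eq_iff)
    then show "out u \<notin> pathd v"
      using pathd_arc(1)[OF out(3)[OF u]] v by metis
  qed (use out[OF u] in auto)
qed

text \<open>The arc leaving \<open>v\<close> lies on \<open>P\<^sub>0(v)\<close>, so here only the
  edges to the children are crossed.\<close>

lemma fan_adj:
  assumes v: "v \<in> inner" "(v, s0) \<in> arcs\<^sup>*" and b: "ext v \<noteq> fc d0"
  shows "(fc (rot (dn v)), fc (up v)) \<in> (adj v)\<^sup>*"
proof (rule fan_connected[OF v(1)])
  fix d assume d: "in0 d" "fst d = v"
  then have dE: "d \<in> E" "\<not> L d" "\<not> L (rot d)"
    by (simp_all add: in0_def)
  have "v \<notin> desc (snd d)"
    using not_in_child_desc[OF d(1)] d(2) v(2) by blast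
  then have "d \<notin> pathd v"
    using pathd_arc(2)[OF in0_child(1)[OF d(1)]] by simp
  moreover have "fc d \<noteq> fc d0" "fc (rot d) \<noteq> fc d0"
    using corner_bounded(2)[of d] corner_bounded(2)[of "rot d"] dE d(2) v(1) b
    by (auto simp: rot_in fst_rot)
  ultimately show "(fc d, fc (rot d)) \<in> adj v"
    using adj_step dE(1) by blast
qed

end

subsection \<open>The order of the vertices along the equator\<close>

definition index :: "'a list \<Rightarrow> 'a \<Rightarrow> nat" where
  "index xs v = (THE i. i < length xs \<and> xs ! i = v)"

lemma index_nth: "distinct xs \<Longrightarrow> i < length xs \<Longrightarrow> index xs (xs ! i) = i"
  unfolding index_def by (rule the_equality) (auto simp: nth_eq_iff_index_eq)

text \<open>Read forwards, the equator makes the subtrees of colour 0 contiguous, read backwards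
  those of colour 1. Assuming both keeps the locale closed under exchanging the labels.\<close>

locale spine = labeled_map V E rot black L s0 s1 d0
  for V :: "'v set" and E rot black L s0 s1 d0 +
  fixes vs :: "'v list"
  assumes spine_run: "run ent ext (fc d0) vs (fc d0)"
    and distinct_spine: "distinct vs"
    and set_spine: "set vs = inner"
    and spine_blocks: "blocks vs"
    and spine_blocks1: "labeled_map.blocks E rot black (\<lambda>d. \<not> L d) (rev vs)"
    and desc_root: "desc s0 = insert s0 inner"
    and desc_root1: "labeled_map.desc E rot (\<lambda>d. \<not> L d) s1 = insert s1 inner"
    and spine_nonempty: "vs \<noteq> []"
begin

lemma flip_spine: "spine V E rot black (\<lambda>d. \<not> L d) s1 s0 (phi rot (phi rot d0)) (rev vs)"
proof -
  interpret F: labeled_map V E rot black "\<lambda>d. \<not> L d" s1 s0 "phi rot (phi rot d0)"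
    by (rule flip)
  have "fc (phi rot (phi rot d0)) = fc d0"
    by (simp add: fc_phi phi_in d0_in)
  then show ?thesis
    using spine_run distinct_spine set_spine spine_blocks spine_blocks1 desc_root desc_root1
      spine_nonempty
    by unfold_locales (auto simp: ent_flip ext_flip run_rev)
qed

text \<open>The special values are those of \<open>f\<^sub>1\<close>: with all \<open>n - 2\<close>
  inner vertices in \<open>vs\<close>, its length is the value at \<open>s0\<close>.\<close>

definition pos :: "'v \<Rightarrow> int" where
  "pos v = (if v = s1 then - 1 else if v = s0 then int (length vs) else int (index vs v))"

lemma innerE:
  assumes "v \<in> inner"
  obtains i where "i < length vs" "vs ! i = v"
  using assms unfolding set_spine[symmetric] in_set_conv_nth by blast

lemma nth_inner: "i < length vs \<Longrightarrow> vs ! i \<in> inner"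
  using set_spine nth_mem by blast

lemma pos_nth: "i < length vs \<Longrightarrow> pos (vs ! i) = int i"
  using nth_inner[of i] distinct_spine by (simp add: pos_def index_nth)

lemma pos_s0: "pos s0 = int (length vs)" and pos_s1: "pos s1 = - 1"
  using s0_neq_s1 by (auto simp: pos_def)

lemma pos_inner: "v \<in> inner \<Longrightarrow> 0 \<le> pos v \<and> pos v < int (length vs)"
  using pos_nth by (metis innerE of_nat_0_le_iff of_nat_less_iff)

lemma inj_pos: "inj_on pos V"
proof (rule inj_onI)
  fix u v assume uv: "u \<in> V" "v \<in> V" "pos u = pos v"
  consider "u \<in> inner" "v \<in> inner" | "u \<notin> inner" | "v \<notin> inner" by blast
  then show "u = v"
  proof cases
    case 1
    then show ?thesis
      using uv(3) pos_nth by (metis innerE of_nat_eq_iff)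
  next
    case 2
    then show ?thesis
      using uv pos_inner[of v] pos_s0 pos_s1 by (cases "v \<in> inner") auto
  next
    case 3
    then show ?thesis
      using uv pos_inner[of u] pos_s0 pos_s1 by (cases "u \<in> inner") auto
  qed
qed

lemma block_at:
  assumes "c \<in> inner"
  obtains as bs cs where "vs = as @ bs @ cs" "block c bs" "bs \<noteq> []"
proof -
  obtain as bs cs where "vs = as @ bs @ cs" "block c bs"
    using assms spine_blocks unfolding blocks_def set_spine by blast
  moreover from this have "c \<in> set bs"
    by (simp add: block_def desc_def)
  ultimately show ?thesis
    using that by fastforce
qed

lemma desc_pos:
  assumes c: "c \<in> inner"
  obtains l r where "desc c = {x \<in> inner. l \<le> pos x \<and> pos x \<le> r}"
    "if black c then pos c = r else pos c = l"
proof -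
  obtain as bs cs where b: "vs = as @ bs @ cs" "block c bs" "bs \<noteq> []"
    using block_at[OF c] .
  let ?l = "int (length as)" and ?r = "int (length as + length bs) - 1"
  have nth: "vs ! (length as + i) = bs ! i" if "i < length bs" for i
    using that b(1) by (simp add: nth_append)
  have set: "set bs = desc c"
    using b(2) by (simp add: block_def)
  have "desc c = {x \<in> inner. ?l \<le> pos x \<and> pos x \<le> ?r}"
  proof (intro set_eqI iffI)
    fix x assume "x \<in> desc c"
    then obtain i where i: "i < length bs" "bs ! i = x"
      unfolding set[symmetric] in_set_conv_nth by blast
    moreover have "x \<in> inner"
      using desc_inner[OF c] \<open>x \<in> desc c\<close> by blast
    ultimately show "x \<in> {x \<in> inner. ?l \<le> pos x \<and> pos x \<le> ?r}"
      using pos_nth[of "length as + i"] nth[OF i(1)] b(1) by auto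
  next
    fix x assume x: "x \<in> {x \<in> inner. ?l \<le> pos x \<and> pos x \<le> ?r}"
    then obtain j where j: "j < length vs" "vs ! j = x"
      using innerE by blast
    then have "bs ! (j - length as) = x" "j - length as < length bs"
      using x pos_nth[OF j(1)] nth[of "j - length as"] by auto
    then show "x \<in> desc c"
      unfolding set[symmetric] by auto
  qed
  moreover obtain n where n: "length bs = Suc n"
    using b(3) by (cases bs) auto
  have "pos (hd bs) = ?l" "pos (last bs) = ?r"
    using b(1,3) n nth[of 0] nth[of n] pos_nth[of "length as"] pos_nth[of "length as + n"]
    by (simp_all add: hd_conv_nth last_conv_nth)
  then have "if black c then pos c = ?r else pos c = ?l"
    using b(2) by (auto simp: block_def)
  ultimately show ?thesis
    using that by blast
qed

text \<open>The subtree of an inner vertex occupies an interval; that of \<open>s0\<close> is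
  everything but \<open>s1\<close>, which comes first.\<close>

lemma desc_convex:
  assumes "c \<in> insert s0 inner" "x \<in> desc c" "z \<in> desc c" "y \<in> V" "pos x \<le> pos y" "pos y \<le> pos z"
  shows "y \<in> desc c"
proof (cases "c \<in> inner")
  case True
  obtain l r where d: "desc c = {x \<in> inner. l \<le> pos x \<and> pos x \<le> r}"
    "if black c then pos c = r else pos c = l"
    using desc_pos[OF True] .
  have "x \<in> inner" "z \<in> inner" "l \<le> pos x" "pos z \<le> r"
    using assms(2,3) unfolding d(1) by blast+
  moreover from this have "y \<in> inner"
    using assms(4-6) pos_inner[of x] pos_inner[of z] pos_s0 pos_s1 by auto
  ultimately show ?thesis
    unfolding d(1) using assms(5,6) by simp
next
  case False
  then have "c = s0" using assms(1) by auto
  then have "x \<in> insert s0 inner"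
    using assms(2) desc_root by simp
  then have "y \<noteq> s1"
    using assms(5) pos_inner[of x] pos_s0 pos_s1 by auto
  then show ?thesis
    using \<open>c = s0\<close> desc_root assms(4) by auto
qed

lemma desc_extreme:
  assumes "c \<in> insert s0 inner" "x \<in> desc c"
  shows "if black c then pos x \<le> pos c else pos c \<le> pos x"
proof (cases "c \<in> inner")
  case True
  then show ?thesis
  proof -
    obtain l r where d: "desc c = {x \<in> inner. l \<le> pos x \<and> pos x \<le> r}"
      "if black c then pos c = r else pos c = l"
      using desc_pos[OF True] .
    show ?thesis
      using assms(2) d(2) unfolding d(1) by auto
  qed
next
  case False
  then have "c = s0" using assms(1) by auto
  moreover have "x \<in> insert s0 inner"
    using assms(2) desc_root \<open>c = s0\<close> by simp
  then have "pos x \<le> pos s0"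
    using pos_s0 pos_inner[of x] by auto
  ultimately show ?thesis
    using black_s0 by simp
qed

section \<open>Alternation and non-crossing for the tree of colour 0\<close>

lemma to_root: "c \<in> inner \<Longrightarrow> (c, s0) \<in> arcs\<^sup>*"
  using desc_root unfolding desc_def by blast

lemma arcs_in:
  assumes "(c, p) \<in> arcs"
  shows "c \<in> inner" "p \<in> insert s0 inner" "black p = (\<not> black c)"
proof -
  show "c \<in> inner"
    using assms by (simp add: arcs_iff)
  have "in0 (p, c)"
    using assms by (simp add: arcs_def)
  then have "(p, c) \<in> E" by (simp add: in0_def)
  then show "p \<in> insert s0 inner" "black p = (\<not> black c)"
    using E_subset assms s1_no_in_arc bipartite[of "(p, c)"] by auto
qed

text \<open>The child lies in the subtree of \<open>p\<close>, and \<open>p\<close> is at the end of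
  that subtree determined by its colour, opposite to that of \<open>c\<close>.\<close>

lemma arc_pos:
  assumes "(c, p) \<in> arcs"
  shows "if black c then pos p < pos c else pos c < pos p"
proof -
  have "c \<in> desc p"
    using assms by (auto simp only: desc_def mem_Collect_eq)
  then have "if black p then pos c \<le> pos p else pos p \<le> pos c"
    using desc_extreme arcs_in(2)[OF assms] by blast
  moreover have "pos c \<noteq> pos p"
    using arcs_in[OF assms] inj_pos s0_in by (auto dest: inj_onD)
  ultimately show ?thesis
    using arcs_in(3)[OF assms] by (auto split: if_splits)
qed

lemma edge_pos:
  assumes "(x, y) \<in> arcs \<or> (y, x) \<in> arcs" "pos x < pos y"
  shows "black y \<and> \<not> black x"
  using assms(1)
proof
  assume "(x, y) \<in> arcs"
  then show ?thesis
    using arc_pos[of x y] arcs_in(3)[of x y] assms(2) by (cases "black x") simp_all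
next
  assume "(y, x) \<in> arcs"
  then show ?thesis
    using arc_pos[of y x] arcs_in(3)[of y x] assms(2) by (cases "black y") simp_all
qed

text \<open>Every edge has its white end first, so a middle vertex would be both black and
  white.\<close>

lemma alternating:
  assumes "(x, y) \<in> arcs \<or> (y, x) \<in> arcs" "(y, z) \<in> arcs \<or> (z, y) \<in> arcs"
  shows "\<not> (pos x < pos y \<and> pos y < pos z)"
  using edge_pos[OF assms(1)] edge_pos[OF assms(2)] by blast

text \<open>Only the arc leaving \<open>z\<close> joins the subtree of \<open>z\<close> to the rest
  of the tree.\<close>

lemma desc_closed_edge:
  assumes "(x, y) \<in> arcs \<or> (y, x) \<in> arcs" "x \<in> desc z" "x \<noteq> z"
  shows "y \<in> desc z"
proof (cases "(x, y) \<in> arcs")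
  case True
  have "(x, z) \<in> arcs\<^sup>*"
    using assms(2) by (simp only: desc_def mem_Collect_eq)
  then show ?thesis
  proof (cases rule: converse_rtranclE)
    case (step w)
    then show ?thesis
      using arcs_functional[OF True step(1)] by (simp only: desc_def mem_Collect_eq)
  qed (use assms(3) in simp)
next
  case False
  then have "(y, x) \<in> arcs" using assms(1) by blast
  then show ?thesis
    using assms(2) unfolding desc_def mem_Collect_eq by (rule converse_rtrancl_into_rtrancl)
qed

lemma noncrossing:
  assumes ac: "(a, c) \<in> arcs \<or> (c, a) \<in> arcs" and bd: "(b, d) \<in> arcs \<or> (d, b) \<in> arcs"
  shows "\<not> (pos a < pos b \<and> pos b < pos c \<and> pos c < pos d)"
proof
  assume lt: "pos a < pos b \<and> pos b < pos c \<and> pos c < pos d"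
  have colors: "\<not> black a" "black c" "\<not> black b" "black d"
    using edge_pos[OF ac] edge_pos[OF bd] lt by auto
  have V: "a \<in> V" "b \<in> V" "c \<in> V" "d \<in> V"
    using ac bd arcs_in(1,2) s0_in by blast+
  show False
  proof (cases "(a, c) \<in> arcs")
    \<comment> \<open>The black \<open>c\<close> is last in its subtree; \<open>b\<close> falls into
      that subtree and hence \<open>d\<close> does, although \<open>d\<close> comes after
      \<open>c\<close>.\<close>
    case True
    have c: "c \<in> insert s0 inner"
      using arcs_in(2)[OF True] .
    have "a \<in> desc c"
      using True by (auto simp only: desc_def mem_Collect_eq)
    then have "b \<in> desc c"
      using desc_convex[OF c _ desc_refl V(2)] lt by simp
    then have "d \<in> desc c"
      using desc_closed_edge[OF bd] lt by auto
    then show False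
      using desc_extreme[OF c] colors(2) lt by fastforce
  next
    case False
    then have ca: "(c, a) \<in> arcs" using ac by blast
    have "a \<noteq> s0" using colors(1) black_s0 by blast
    then have a: "a \<in> inner"
      using arcs_in(2)[OF ca] by blast
    have "c \<in> desc a"
      using ca by (auto simp only: desc_def mem_Collect_eq)
    then have "b \<in> desc a"
      using desc_convex[OF _ desc_refl _ V(2)] a lt by simp
    then have "(b, a) \<in> arcs\<^sup>*"
      by (simp only: desc_def mem_Collect_eq)
    moreover have "b \<noteq> a" using lt by auto
    \<comment> \<open>The child \<open>z\<close> of \<open>a\<close> above \<open>b\<close> is
      black, hence last in its subtree, which contains \<open>b\<close> and so \<open>d\<close>.
      Then \<open>c\<close>, lying between \<open>b\<close> and \<open>z\<close>, would be below its
      sibling \<open>z\<close>.\<close>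
    ultimately obtain z where z: "(b, z) \<in> arcs\<^sup>*" "(z, a) \<in> arcs"
      by (meson rtranclE)
    have bz: "b \<in> desc z"
      using z(1) by (simp only: desc_def mem_Collect_eq)
    have zin: "z \<in> insert s0 inner" and "black z"
      using arcs_in[OF z(2)] colors(1) by auto
    then have "d \<in> desc z"
      using desc_closed_edge[OF bd bz] colors(3) by blast
    then have "pos d \<le> pos z"
      using desc_extreme[OF zin] \<open>black z\<close> by fastforce
    then have "c \<in> desc z" "c \<noteq> z"
      using desc_convex[OF zin bz desc_refl V(3)] lt by auto
    then have "(c, z) \<in> arcs\<^sup>*"
      by (simp only: desc_def mem_Collect_eq)
    then show False
      using siblings_incomparable[OF ca z(2) \<open>c \<noteq> z\<close> to_root[OF a]] by blast
  qed
qed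

section \<open>The faces met before a vertex\<close>

lemma ent_first: "ent (vs ! 0) = fc d0" and ext_last: "ext (last vs) = fc d0"
  using run_hd_last[OF spine_run spine_nonempty] spine_nonempty by (simp_all add: hd_conv_nth)

lemma ext_nth: "Suc i < length vs \<Longrightarrow> ext (vs ! i) = ent (vs ! Suc i)"
  using run_nth[OF spine_run] .

lemma ent_nth_eq:
  assumes "i < length vs" "j < length vs"
  shows "ent (vs ! i) = ent (vs ! j) \<longleftrightarrow> i = j"
  using ent_inj[OF nth_inner nth_inner] assms distinct_spine nth_eq_iff_index_eq by blast

lemma ent_nth_outer: "i < length vs \<Longrightarrow> ent (vs ! i) = fc d0 \<longleftrightarrow> i = 0"
  using ent_nth_eq[of i 0] ent_first spine_nonempty by auto

text \<open>Index 0 contributes the outer face.\<close>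

definition before :: "nat \<Rightarrow> ('v \<times> 'v) set set" where
  "before k = (\<lambda>i. ent (vs ! i)) ` {..k}"

lemma ent_before:
  assumes "i < length vs" "k < length vs"
  shows "ent (vs ! i) \<in> before k \<longleftrightarrow> i \<le> k"
  using assms ent_nth_eq unfolding before_def by (auto intro!: imageI)

lemma segment_nth:
  assumes "vs = as @ bs @ cs" "length bs = Suc n" "k < length vs"
  shows "hd bs = vs ! length as" "last bs = vs ! (length as + n)"
    "vs ! k \<in> set bs \<longleftrightarrow> length as \<le> k \<and> k \<le> length as + n"
proof -
  have "bs \<noteq> []" using assms(2) by auto
  then show "hd bs = vs ! length as" "last bs = vs ! (length as + n)"
    using assms by (simp_all add: hd_conv_nth last_conv_nth nth_append)
  show "vs ! k \<in> set bs \<longleftrightarrow> length as \<le> k \<and> k \<le> length as + n"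
  proof
    assume "vs ! k \<in> set bs"
    then obtain i where i: "i < length bs" "bs ! i = vs ! k"
      unfolding in_set_conv_nth by blast
    then have "vs ! (length as + i) = vs ! k"
      using assms(1) by (simp add: nth_append)
    then have "length as + i = k"
      using distinct_spine assms(3) i(1) assms(1) nth_eq_iff_index_eq[of vs "length as + i" k] by simp
    then show "length as \<le> k \<and> k \<le> length as + n"
      using i(1) assms(2) by simp
  next
    assume k: "length as \<le> k \<and> k \<le> length as + n"
    then have "k - length as < length bs"
      using assms(2) by auto
    moreover from this have "vs ! k = bs ! (k - length as)"
      using k assms(1) by (simp add: nth_append)
    ultimately show "vs ! k \<in> set bs"
      by simp
  qed
qed

text \<open>A segment avoiding position \<open>k\<close> lies entirely before or after it. Its exit
  face is the entry face of the next vertex, so both its end faces are on the same side of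
  \<open>k\<close>.\<close>

lemma segment_cross:
  assumes bs: "vs = as @ bs @ cs" "bs \<noteq> []" and k: "k < length vs" "vs ! k \<notin> set bs"
    and "ext (last bs) \<noteq> fc d0"
  shows "ent (hd bs) \<in> before k \<longleftrightarrow> ext (last bs) \<in> before k"
proof -
  obtain n where n: "length bs = Suc n"
    using bs(2) by (cases bs) auto
  \<comment> \<open>The last vertex leaves to the outer face, so by assumption the segment has a
    successor.\<close>
  have "cs \<noteq> []"
  proof
    assume "cs = []"
    then have "last vs = last bs"
      unfolding bs(1) using bs(2) by simp
    then show False
      using assms(5) ext_last by simp
  qed
  then have l: "length as + Suc n < length vs"
    using bs(1) n by simp
  then have "ext (last bs) = ent (vs ! (length as + Suc n))"
    using ext_nth[of "length as + n"] segment_nth(2)[OF bs(1) n k(1)] by simp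
  moreover have "\<not> (length as \<le> k \<and> k \<le> length as + n)"
    using segment_nth(3)[OF bs(1) n k(1)] k(2) by simp
  ultimately show ?thesis
    using ent_before[OF l k(1)] ent_before[of "length as" k] l k(1)
      segment_nth(1)[OF bs(1) n k(1)] by auto
qed

lemma segment_start:
  assumes bs: "vs = as @ bs @ cs" and k: "k < length vs" "vs ! k \<in> set bs"
  shows "ent (hd bs) \<in> before k"
proof -
  obtain n where n: "length bs = Suc n"
    using k(2) by (cases bs) auto
  then show ?thesis
    using ent_before[of "length as" k] segment_nth[OF bs(1) n k(1)] k by simp
qed

end

text \<open>The walks around the two trees both start in the outer face, and a face determines the
  next vertex, so each walk is the reversal of the other. The two components thus have the same
  inner vertices, and connectedness makes these all of them.\<close>

lemma (in labeled_map) spine_exists: "\<exists>vs. spine V E rot black L s0 s1 d0 vs"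
proof -
  interpret F: labeled_map V E rot black "\<lambda>d. \<not> L d" s1 s0 "phi rot (phi rot d0)"
    by (rule flip)
  obtain vs where vs: "run ent ext (fc d0) vs (fc d0)" "distinct vs" "blocks vs"
    "set vs = desc s0 - {s0}" "vs \<noteq> []"
    using root_run by blast
  have "fc (phi rot (phi rot d0)) = fc d0"
    by (simp add: fc_phi phi_in d0_in)
  then obtain ws where ws: "run ext ent (fc d0) ws (fc d0)" "distinct ws" "F.blocks ws"
    "set ws = F.desc s1 - {s1}" "ws \<noteq> []"
    using F.root_run[unfolded ent_flip ext_flip] by metis
  have sub: "set vs \<subseteq> inner" "set ws \<subseteq> inner"
    using desc_root_subset F.desc_root_subset vs(4) ws(4) by blast+
  have "vs = rev ws"
  proof (rule closed_run_unique)
    show "run ent ext (fc d0) (rev ws) (fc d0)"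
      using ws(1) by (simp add: run_rev)
    show "inj_on ent (set vs \<union> set (rev ws))"
      unfolding set_rev using sub by (intro inj_onI ent_inj) blast+
  qed (use vs ws in auto)
  then have X: "desc s0 - {s0} = F.desc s1 - {s1}"
    using vs(4) ws(4) by simp
  \<comment> \<open>\<open>Y\<close> can be described by either component, hence is closed under the
    edges of both colours.\<close>
  define Y where "Y = insert s0 (insert s1 (desc s0))"
  have Y: "Y = insert s0 (insert s1 (F.desc s1))"
    using X by (auto simp: Y_def)
  have sub0: "s1 \<notin> desc s0" "s0 \<notin> F.desc s1" "s0 \<in> desc s0" "s1 \<in> F.desc s1"
    using desc_root_subset F.desc_root_subset s0_neq_s1 desc_refl F.desc_refl by blast+
  have arc0: "c \<in> Y \<longleftrightarrow> p \<in> Y" if "(c, p) \<in> arcs" for c p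
  proof -
    have "c \<noteq> s0" "c \<noteq> s1" "p \<noteq> s1"
      using that s1_no_in_arc by (auto simp: arcs_iff)
    then show ?thesis
      using arcs_desc_root[OF that] sub0 unfolding Y_def by blast
  qed
  have arc1: "c \<in> Y \<longleftrightarrow> p \<in> Y" if "(c, p) \<in> F.arcs" for c p
  proof -
    have "c \<noteq> s0" "c \<noteq> s1" "p \<noteq> s0"
      using that F.s1_no_in_arc by (auto simp: F.arcs_iff)
    then show ?thesis
      using F.arcs_desc_root[OF that] sub0 unfolding Y by blast
  qed
  have closed: "w \<in> Y" if "(u, w) \<in> E" "u \<in> Y" for u w
  proof -
    have "(w, u) \<in> arcs \<or> (u, w) \<in> arcs \<or> (w, u) \<in> F.arcs \<or> (u, w) \<in> F.arcs"
      using edge_arcs[OF that(1)] .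
    then show ?thesis
      using that(2) arc0 arc1 by blast
  qed
  have "v \<in> Y" if "v \<in> V" for v
    using connected[OF s0_in that]
  proof induction
    case (step y z)
    then show ?case using closed by blast
  qed (simp add: Y_def)
  then have "inner = desc s0 - {s0}"
    using desc_root_subset s0_in unfolding Y_def by blast
  then have "desc s0 = insert s0 inner" "F.desc s1 = insert s1 inner" "set vs = inner"
    using X sub0 vs(4) by blast+
  then show ?thesis
    using vs ws(3) \<open>vs = rev ws\<close> by (intro exI[of _ vs]) (unfold_locales; simp)
qed

section \<open>The region to the right of the path of colour 1\<close>

context spine
begin

interpretation F: spine V E rot black "\<lambda>d. \<not> L d" s1 s0 "phi rot (phi rot d0)" "rev vs"
  by (rule flip_spine)

lemma pos_flip:
  assumes "v \<in> V"
  shows "F.pos v = int (length vs) - 1 - pos v"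
proof (cases "v \<in> inner")
  case True
  then obtain i where i: "i < length vs" "vs ! i = v"
    by (rule innerE)
  then have "rev vs ! (length vs - Suc i) = v"
    by (simp add: rev_nth)
  then show ?thesis
    using F.pos_nth[of "length vs - Suc i"] i pos_nth[of i] by auto
next
  case False
  then have "v = s0 \<or> v = s1" using assms by blast
  then show ?thesis
    using F.pos_s0 F.pos_s1 pos_s0 pos_s1 by auto
qed

text \<open>In the order along the equator \<open>u\<close> is last in one of its two subtrees and
  first in the other. Equivalently, \<open>P\<^sub>0(v)\<close> and \<open>P\<^sub>1(v)\<close>
  share only \<open>v\<close>.\<close>

lemma desc_both:
  assumes "u \<in> inner" "v \<in> desc u" "v \<in> F.desc u"
  shows "v = u"
proof -
  have v: "v \<in> inner"
    using desc_inner[OF assms(1)] assms(2) by blast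
  have "F.pos v = int (length vs) - 1 - pos v" "F.pos u = int (length vs) - 1 - pos u"
    using pos_flip v assms(1) by blast+
  moreover have "if black u then pos v \<le> pos u else pos u \<le> pos v"
    "if black u then F.pos v \<le> F.pos u else F.pos u \<le> F.pos v"
    using desc_extreme[OF _ assms(2)] F.desc_extreme[OF _ assms(3)] assms(1) by blast+
  ultimately have "pos v = pos u"
    by (cases "black u") simp_all
  then show ?thesis
    using inj_onD[OF inj_pos] v assms(1) by blast
qed

text \<open>The two faces at the arc leaving \<open>c\<close> are the ends of the block of
  \<open>c\<close>, a segment avoiding position \<open>k\<close>.\<close>

lemma cross_arc0:
  assumes "(c, p) \<in> arcs" "k < length vs" "vs ! k \<notin> desc c" "fc (c, p) \<noteq> fc d0"
  shows "fc (p, c) \<in> before k \<longleftrightarrow> fc (c, p) \<in> before k"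
proof -
  have c: "c \<in> inner" "out c = (c, p)"
    using assms(1) by (simp_all add: arcs_iff)
  obtain as bs cs where b: "vs = as @ bs @ cs" "block c bs" "bs \<noteq> []"
    using block_at[OF c(1)] .
  have "fc (rot (c, p)) = fc (p, c)"
    using fc_rot out(1)[OF c(1)] c(2) by simp
  then have "ent (hd bs) = fc (p, c)" "ext (last bs) = fc (c, p)" "set bs = desc c"
    using b(2) run_hd_last[OF _ b(3)] unfolding block_def c(2) by metis+
  then show ?thesis
    using segment_cross[OF b(1,3) assms(2)] assms(3,4) by simp
qed

text \<open>Blocks of colour 1 are segments of \<open>rev vs\<close>; read along \<open>vs\<close>,
  their entry and exit faces are exchanged.\<close>

lemma block1_at:
  assumes "(c, p) \<in> F.arcs"
  obtains as bs cs where "vs = as @ bs @ cs" "bs \<noteq> []" "set bs = F.desc c"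
    "ent (hd bs) = fc (c, p)" "ext (last bs) = fc (p, c)"
proof -
  have c: "c \<in> V - {s1, s0}" "F.out c = (c, p)"
    using assms by (simp_all add: F.arcs_iff)
  obtain as bs cs where b: "rev vs = as @ bs @ cs" "F.block c bs" "bs \<noteq> []"
    using F.block_at[OF c(1)] .
  have vs: "vs = rev cs @ rev bs @ rev as"
    using arg_cong[OF b(1), of rev] by simp
  have "fc (rot (c, p)) = fc (p, c)"
    using fc_rot F.out(1)[OF c(1)] c(2) by simp
  then have "ext (hd bs) = fc (p, c)" "ent (last bs) = fc (c, p)" "set bs = F.desc c"
    using b(2) run_hd_last[OF _ b(3)] unfolding F.block_def c(2) ent_flip ext_flip by metis+
  then show ?thesis
    using that[OF vs] b(3) by (simp add: hd_rev last_rev)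
qed

lemma cross_arc1:
  assumes "(c, p) \<in> F.arcs" "k < length vs" "vs ! k \<notin> F.desc c" "fc (p, c) \<noteq> fc d0"
  shows "fc (c, p) \<in> before k \<longleftrightarrow> fc (p, c) \<in> before k"
proof -
  obtain as bs cs where b: "vs = as @ bs @ cs" "bs \<noteq> []" "set bs = F.desc c"
    "ent (hd bs) = fc (c, p)" "ext (last bs) = fc (p, c)"
    using block1_at[OF assms(1)] .
  show ?thesis
    using segment_cross[OF b(1,2) assms(2)] assms(3,4) b(3-5) by simp
qed

lemma pathd_arc1:
  assumes "(c, p) \<in> F.arcs"
  shows "(c, p) \<in> pathd v \<longleftrightarrow> v \<in> F.desc c" "(p, c) \<in> pathd v \<longleftrightarrow> v \<in> F.desc c"
  using F.pathd_arc[OF assms] unfolding pathd_flip .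

text \<open>Whatever its colour, an edge off both paths bounds the block of its tail, which avoids
  \<open>vs ! k\<close>.\<close>

lemma cross_closed:
  assumes "d \<in> E" "fc d \<noteq> fc d0" "fc (rv d) \<noteq> fc d0" "d \<notin> pathd (vs ! k)" "k < length vs"
  shows "fc d \<in> before k \<longleftrightarrow> fc (rv d) \<in> before k"
proof -
  obtain x y where d: "d = (x, y)" by (cases d)
  have "(y, x) \<in> arcs \<or> (x, y) \<in> arcs \<or> (y, x) \<in> F.arcs \<or> (x, y) \<in> F.arcs"
    using edge_arcs assms(1) unfolding d .
  then show ?thesis
    using cross_arc0[of y x k] cross_arc0[of x y k] cross_arc1[of y x k] cross_arc1[of x y k]
      pathd_arc[of y x "vs ! k"] pathd_arc[of x y "vs ! k"]
      pathd_arc1[of y x "vs ! k"] pathd_arc1[of x y "vs ! k"] assms(2-5)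
    unfolding d fst_conv snd_conv by blast
qed

text \<open>Induction downwards from \<open>k\<close>. One passes back over each vertex
  \<open>u\<close> by turning around it on the side of a colour in which \<open>vs ! k\<close> is
  not below \<open>u\<close>; \<open>desc_both\<close> provides such a colour.\<close>

lemma reach:
  assumes k: "k < length vs" and i: "1 \<le> i" "i \<le> k"
  shows "(fc (F.out (vs ! k)), ent (vs ! i)) \<in> (adj (vs ! k))\<^sup>*"
  using i(2,1)
proof (induction i rule: inc_induct)
  case base
  let ?v = "vs ! k"
  have v: "?v \<in> inner" using nth_inner[OF k] .
  have e: "ent ?v \<noteq> fc d0"
    using ent_nth_outer[OF k] base by simp
  show ?case
  proof (cases "black ?v")
    case True
    then show ?thesis
      by (simp add: F.out_def up_flip ent_def)
  next
    case False
    \<comment> \<open>These faces are the two ends of the fan of labels 1 at \<open>?v\<close>,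
      crossed by the edges to its children of colour 1.\<close>
    have "(fc (rot (up ?v)), fc (dn ?v)) \<in> (adj ?v)\<^sup>*"
      using F.fan_adj[of ?v] F.to_root[of ?v] v e
      by (simp add: dn_flip up_flip ext_flip ent_flip adj_flip fc_d1)
    then have "(fc (dn ?v), fc (rot (up ?v))) \<in> (adj ?v)\<^sup>*"
      using sym_rtrancl[OF sym_adj] by (meson symD)
    then show ?thesis
      using False by (simp add: F.out_def dn_flip ent_def)
  qed
next
  case (step i)
  let ?v = "vs ! k" and ?u = "vs ! i"
  have l: "Suc i < length vs" "i < length vs"
    using step.hyps k by simp_all
  have u: "?u \<in> inner" using nth_inner[OF l(2)] .
  have e: "ext ?u = ent (vs ! Suc i)"
    using ext_nth[OF l(1)] .
  have b: "ent ?u \<noteq> fc d0" "ext ?u \<noteq> fc d0"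
    using ent_nth_outer[OF l(1)] ent_nth_outer[OF l(2)] step.prems e by simp_all
  have "?v \<noteq> ?u"
    using distinct_spine k l(2) step.hyps nth_eq_iff_index_eq[of vs k i] by simp
  then consider "?v \<notin> desc ?u" | "?v \<notin> F.desc ?u"
    using desc_both[OF u] by blast
  then have "(ext ?u, ent ?u) \<in> (adj ?v)\<^sup>*"
  proof cases
    case 1
    then show ?thesis
      using ent_ext_adj[OF u b] sym_rtrancl[OF sym_adj] by (meson symD)
  next
    case 2
    then show ?thesis
      using F.ent_ext_adj[of ?u ?v] u b by (simp add: ext_flip ent_flip adj_flip fc_d1)
  qed
  moreover have "(fc (F.out ?v), ext ?u) \<in> (adj ?v)\<^sup>*"
    using step.IH e by simp
  ultimately show ?case
    by (rule rtrancl_trans[rotated])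
qed

text \<open>\<open>before k\<close> contains the starting faces and is preserved by the moves, which
  gives one inclusion; \<open>reach\<close> gives the other. Index 0 is left out because it is the
  outer face.\<close>

lemma region:
  assumes k: "k < length vs"
  shows "{G \<in> bounded. \<exists>F\<in>bounded \<inter> fc ` {(x, y) \<in> F.arcs. (vs ! k, x) \<in> F.arcs\<^sup>*}.
      (F, G) \<in> (adj (vs ! k))\<^sup>*} = (\<lambda>i. ent (vs ! i)) ` {1..k}" (is "?R = ?S")
proof (intro set_eqI iffI)
  let ?v = "vs ! k"
  fix G assume "G \<in> ?R"
  then obtain x y where G: "G \<in> bounded" "(x, y) \<in> F.arcs" "(?v, x) \<in> F.arcs\<^sup>*"
    "(fc (x, y), G) \<in> (adj ?v)\<^sup>*"
    by blast
  have "?v \<in> F.desc x"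
    using G(3) by (simp only: F.desc_def mem_Collect_eq)
  then have "fc (x, y) \<in> before k"
    using block1_at[OF G(2)] segment_start[OF _ k] by metis
  with G(4) have "G \<in> before k"
  proof induction
    case (step F G)
    obtain d where d: "F \<in> bounded" "G \<in> bounded" "d \<in> F" "d \<notin> pathd ?v" "rv d \<in> G"
      using step.hyps(2) unfolding adj_def by blast
    have F: "d \<in> E" "fc d = F" "fc (rv d) = G"
      using d(1,2,3,5) fc_mem unfolding bounded_def by blast+
    have "F \<noteq> fc d0" "G \<noteq> fc d0"
      using d(1,2) by (simp_all add: bounded_def)
    then show ?case
      using cross_closed[OF F(1) _ _ d(4) k] F(2,3) step by simp
  qed
  then obtain i where "i \<le> k" "G = ent (vs ! i)"
    by (auto simp: before_def)
  moreover from this have "i \<noteq> 0"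
    using G(1) ent_first by (auto simp: bounded_def)
  ultimately show "G \<in> ?S"
    by auto
next
  let ?v = "vs ! k"
  have v: "?v \<in> inner" using nth_inner[OF k] .
  fix G assume "G \<in> ?S"
  then obtain i where i: "1 \<le> i" "i \<le> k" "G = ent (vs ! i)"
    by auto
  have ent_E: "ent u \<in> fc ` E" if "u \<in> inner" for u
    using up(1)[OF that] rot_in by (auto simp: ent_def)
  have G: "G \<in> bounded"
    using i k ent_nth_outer[of i] ent_E nth_inner[of i] by (simp add: bounded_def)
  have out: "F.out ?v \<in> E" "fst (F.out ?v) = ?v" "(?v, snd (F.out ?v)) \<in> F.arcs"
    using F.out[of ?v] v by auto
  \<comment> \<open>The first alternative holds for white \<open>?v\<close>, the second for black;
    each excludes the outer face.\<close>
  have "L (F.out ?v) \<or> fc (F.out ?v) = ent ?v"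
    using dn(3)[OF v] by (simp add: F.out_def up_flip dn_flip ent_def)
  moreover have "ent ?v \<noteq> fc d0"
    using ent_nth_outer[OF k] i by simp
  ultimately have "fc (F.out ?v) \<noteq> fc d0"
    using corner_bounded(1)[OF out(1)] out(2) v by auto
  then have "fc (F.out ?v) \<in> bounded"
    using out(1) by (simp add: bounded_def)
  moreover have "fc (F.out ?v) \<in> fc ` {(x, y) \<in> F.arcs. (?v, x) \<in> F.arcs\<^sup>*}"
  proof (rule imageI)
    obtain y where "F.out ?v = (?v, y)"
      using out(2) by (cases "F.out ?v") simp
    then show "F.out ?v \<in> {(x, y) \<in> F.arcs. (?v, x) \<in> F.arcs\<^sup>*}"
      using out(3) by simp
  qed
  ultimately have "fc (F.out ?v) \<in> bounded \<inter> fc ` {(x, y) \<in> F.arcs. (?v, x) \<in> F.arcs\<^sup>*}"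
    by (rule IntI)
  then show "G \<in> ?R"
    using G reach[OF k i(1,2)] unfolding i(3) mem_Collect_eq by (intro conjI bexI)
qed

lemma arcs1_in: "(x, y) \<in> F.arcs \<Longrightarrow> x \<in> V \<and> y \<in> V"
  using F.arcs_in(1,2) F.s0_in by blast

lemma alternating1:
  assumes "(x, y) \<in> F.arcs \<or> (y, x) \<in> F.arcs" "(y, z) \<in> F.arcs \<or> (z, y) \<in> F.arcs"
  shows "\<not> (pos x < pos y \<and> pos y < pos z)"
proof -
  have "\<not> (F.pos z < F.pos y \<and> F.pos y < F.pos x)"
    using F.alternating assms by blast
  moreover have "x \<in> V" "y \<in> V" "z \<in> V"
    using arcs1_in assms by blast+
  ultimately show ?thesis
    by (auto simp: pos_flip)
qed

lemma noncrossing1: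
  assumes "(a, c) \<in> F.arcs \<or> (c, a) \<in> F.arcs" "(b, d) \<in> F.arcs \<or> (d, b) \<in> F.arcs"
  shows "\<not> (pos a < pos b \<and> pos b < pos c \<and> pos c < pos d)"
proof -
  have "\<not> (F.pos d < F.pos c \<and> F.pos c < F.pos b \<and> F.pos b < F.pos a)"
    using F.noncrossing[of d b c a] assms by blast
  moreover have "a \<in> V" "b \<in> V" "c \<in> V" "d \<in> V"
    using arcs1_in assms by blast+
  ultimately show ?thesis
    by (auto simp: pos_flip)
qed

lemma card_region: "k < length vs \<Longrightarrow> card ((\<lambda>i. ent (vs ! i)) ` {1..k}) = k"
  using ent_nth_eq by (subst card_image) (auto intro!: inj_onI)

end

section \<open>From quadrangulations and strong labelings to the locales\<close>

lemma quad_map_if_quadrangulation: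
  assumes "quadrangulation V E rot dout black"
  shows "quad_map V E rot black"
proof -
  have q: "finite V" "E \<subseteq> V \<times> V" "\<forall>(u, w)\<in>E. u \<noteq> w \<and> (w, u) \<in> E" "bij_betw rot E E"
    "\<forall>d\<in>E. fst (rot d) = fst d"
    "\<forall>d\<in>E. \<forall>d'\<in>E. fst d = fst d' \<longrightarrow> (\<exists>k::nat. (rot ^^ k) d = d')"
    "\<forall>u\<in>V. \<forall>w\<in>V. (u, w) \<in> E\<^sup>*" "\<forall>d\<in>E. (phi rot ^^ 4) d = d"
    "\<forall>(u, w)\<in>E. black u \<noteq> black w"
    using assms unfolding quadrangulation_def plane_graph_def rotation_system_def by blast+
  show ?thesis
  proof
    show "d \<in> E \<Longrightarrow> rot d \<in> E" for d
      using q(4) bij_betwE by metis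
    show "inj_on rot E"
      using q(4) by (rule bij_betw_imp_inj_on)
    show "d \<in> E \<Longrightarrow> rv d \<in> E" "d \<in> E \<Longrightarrow> black (snd d) = (\<not> black (fst d))" for d
      using q(3,9) by (cases d; fastforce)+
  qed (use q in blast)+
qed

lemma labeled_map_if_strong_labeling:
  assumes Q: "quadrangulation V E rot dout black"
    and S: "strong_labeling V E rot dout black s0 s1 lab"
  shows "\<exists>d0. labeled_map V E rot black (\<lambda>d. lab d = 1) s0 s1 d0 \<and>
    face_of rot d0 = outer_face rot dout"
proof -
  interpret quad_map V E rot black
    using quad_map_if_quadrangulation[OF Q] .
  let ?p = "phi rot" and ?L = "\<lambda>d. lab d = 1"
  have dout: "dout \<in> E"
    using Q by (simp add: quadrangulation_def)
  have lab01: "lab d = 0 \<or> lab d = 1" if "d \<in> E" for d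
    using S that unfolding strong_labeling_def by blast
  have s: "s0 \<noteq> s1" "black s0" "black s1" "s1 \<in> fst ` outer_face rot dout"
    "\<forall>d\<in>E. fst d = s0 \<longrightarrow> lab d = 0" "\<forall>d\<in>E. fst d = s1 \<longrightarrow> lab d = 1"
    using S unfolding strong_labeling_def by blast+
  have G1: "\<forall>v\<in>V - {s0, s1}. \<exists>d\<in>darts_at E v. \<exists>k. 0 < k \<and> k < card (darts_at E v) \<and>
        (\<forall>j < card (darts_at E v). lab ((rot ^^ j) d) = (if j < k then 1 else 0))"
    and G2: "\<forall>(u,w)\<in>E. (lab (u,w) = lab (rot (u,w))) \<noteq> (lab (w,u) = lab (rot (w,u)))"
    and G3: "\<forall>d\<in>E. face_of rot d \<noteq> outer_face rot dout \<longrightarrow>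
        (\<exists>j<4. lab ((?p ^^ j) d) = 0 \<and> lab ((?p ^^ (j+1)) d) = 0 \<and>
               lab ((?p ^^ (j+2)) d) = 1 \<and> lab ((?p ^^ (j+3)) d) = 1)"
    using S unfolding strong_labeling_def by blast+
  obtain d0 where "d0 \<in> outer_face rot dout" and d0: "fst d0 = s0" "lab d0 = 0"
    "lab ((?p ^^ 3) d0) = 0" "lab ((?p ^^ 2) d0) = 1" "lab (?p d0) = 1"
    using S unfolding strong_labeling_def by blast
  then have d0E: "d0 \<in> E" and out: "fc d0 = outer_face rot dout"
    using fc_mem[OF dout] by (auto simp: outer_face_def)
  have alt: "(?L (?p d) = ?L d) \<noteq> (?L (?p (?p d)) = ?L (?p d))" if d: "d \<in> E" for d
  proof (cases "fc d = outer_face rot dout")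
    case True
    \<comment> \<open>The outer face is read clockwise, against \<open>phi\<close>; in
      \<open>phi\<close> order its pattern 0, 0, 1, 1 starts at the dart before
      \<open>d0\<close>.\<close>
    let ?e = "?p (?p (?p d0))"
    have "?e \<in> E" "fc ?e = fc d0"
      using d0E by (simp_all add: phi_in fc_phi)
    moreover have "d \<in> fc d0"
      using in_fc[OF d] True out by simp
    moreover have "\<not> ?L ?e" "\<not> ?L (?p ?e)" "?L (?p (?p ?e))" "?L (?p (?p (?p ?e)))"
      using d0(2-5) phi4'[OF d0E] by (simp_all add: eval_nat_numeral)
    ultimately show ?thesis
      using face_alternates[of ?e d ?L] by simp
  next
    case False
    then obtain j where j: "lab ((?p ^^ j) d) = 0" "lab ((?p ^^ (j+1)) d) = 0"
      "lab ((?p ^^ (j+2)) d) = 1" "lab ((?p ^^ (j+3)) d) = 1"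
      using G3 d by blast
    have e: "(?p ^^ j) d \<in> E \<and> fc ((?p ^^ j) d) = fc d"
      by (induction j) (simp_all add: d phi_in fc_phi)
    then have "d \<in> fc ((?p ^^ j) d)"
      using in_fc[OF d] by simp
    then show ?thesis
      using face_alternates[of "(?p ^^ j) d" d ?L] e j by (simp add: eval_nat_numeral)
  qed
  have edge: "(?L d = ?L (rot d)) \<noteq> (?L (rv d) = ?L (rot (rv d)))" if "d \<in> E" for d
  proof -
    have "(lab d = lab (rot d)) \<noteq> (lab (rv d) = lab (rot (rv d)))"
      using G2 that by (cases d) auto
    then show ?thesis
      using lab01[OF that] lab01[OF rot_in[OF that]] lab01[OF rv_in[OF that]]
        lab01[OF rot_in[OF rv_in[OF that]]] by auto
  qed
  have "labeled_map V E rot black ?L s0 s1 d0"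
  proof unfold_locales
    \<comment> \<open>The rule starts at \<open>d0\<close>, where the tail \<open>s0\<close> is
      black and the label changes from 0 to 1.\<close>
    show "?L (?p d) = (?L d \<noteq> black (fst d))" if "d \<in> E" for d
      by (rule label_change[OF alt edge d0E _ that]) (use d0 s(2) in auto)
    have interval: "\<exists>d\<in>E. \<exists>k. fst d = v \<and> 0 < k \<and> k < card (darts_at E v) \<and>
        (\<forall>j<card (darts_at E v). ?L ((rot ^^ j) d) = (j < k))" if "v \<in> V - {s0, s1}" for v
    proof -
      obtain d k where "d \<in> darts_at E v" "0 < k" "k < card (darts_at E v)"
        "\<forall>j < card (darts_at E v). lab ((rot ^^ j) d) = (if j < k then 1 else 0)"
        using G1 \<open>v \<in> V - {s0, s1}\<close> by blast
      then show ?thesis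
        by (intro bexI[of _ d] exI[of _ k]) (auto simp: darts_at_def)
    qed
    show "\<exists>d\<in>E. \<exists>m. fst d = v \<and> (\<forall>j\<le>m. \<not> ?L ((rot ^^ j) d)) \<and>
        ?L ((rot ^^ Suc m) d) \<and> {e \<in> E. fst e = v \<and> \<not> ?L e} = (\<lambda>j. (rot ^^ j) d) ` {..m}"
      if v: "v \<in> V - {s0, s1}" for v
    proof -
      obtain d k where "d \<in> E" "fst d = v" "0 < k" "k < card (darts_at E v)"
        "\<forall>j<card (darts_at E v). ?L ((rot ^^ j) d) = (j < k)"
        using interval[OF v] by blast
      then show ?thesis
        by (rule cyclic_intervals(1)[where L = ?L])
    qed
    show "\<exists>d\<in>E. \<exists>m. fst d = v \<and> (\<forall>j\<le>m. ?L ((rot ^^ j) d)) \<and>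
        \<not> ?L ((rot ^^ Suc m) d) \<and> {e \<in> E. fst e = v \<and> ?L e} = (\<lambda>j. (rot ^^ j) d) ` {..m}"
      if v: "v \<in> V - {s0, s1}" for v
    proof -
      obtain d k where "d \<in> E" "fst d = v" "0 < k" "k < card (darts_at E v)"
        "\<forall>j<card (darts_at E v). ?L ((rot ^^ j) d) = (j < k)"
        using interval[OF v] by blast
      then show ?thesis
        by (rule cyclic_intervals(2)[where L = ?L])
    qed
    show "fst (?p (?p d0)) = s1"
    proof -
      obtain e where e: "e \<in> fc d0" "fst e = s1"
        using s(4) out by auto
      \<comment> \<open>Only the corner opposite to \<open>d0\<close> is left for the black vertex
        \<open>s1\<close>.\<close>
      have "\<not> black (fst (?p d0))" "\<not> black (fst (?p (?p (?p d0))))"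
        using d0E d0(1) s(2) by (simp_all add: phi_in fst_phi bipartite)
      then show ?thesis
        using e s(1,3) d0(1) unfolding fc_eq[OF d0E] by auto
    qed
  qed (use s d0 d0E in auto)
  then show ?thesis
    using out by blast
qed

lemma fval_eq_pos:
  assumes "spine V E rot black (\<lambda>d. lab d = 1) s0 s1 d0 vs"
    and lab01: "\<And>d. d \<in> E \<Longrightarrow> lab d = 0 \<or> lab d = 1"
    and outer: "face_of rot d0 = outer_face rot dout"
    and v: "v \<in> V"
  shows "fval V E rot dout s0 s1 lab 1 v = spine.pos s0 s1 vs v"
    and "tree_arcs E rot lab 0 = labeled_map.arcs E rot (\<lambda>d. lab d = 1)"
    and "tree_arcs E rot lab 1 = labeled_map.arcs E rot (\<lambda>d. \<not> lab d = 1)"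
proof -
  interpret spine V E rot black "\<lambda>d. lab d = 1" s0 s1 d0 vs
    by fact
  interpret F: labeled_map V E rot black "\<lambda>d. \<not> lab d = 1" s1 s0 "phi rot (phi rot d0)"
    by (rule flip)
  have lab0: "d \<in> E \<Longrightarrow> lab d = 0 \<longleftrightarrow> lab d \<noteq> 1" for d
    using lab01[of d] by auto
  show t0: "tree_arcs E rot lab 0 = arcs"
    by (auto simp: tree_arcs_def arcs_def in0_def lab0 rot_in simp del: One_nat_def)
  show t1: "tree_arcs E rot lab 1 = F.arcs"
    by (auto simp: tree_arcs_def F.arcs_def F.in0_def simp del: One_nat_def)
  have region': "region_faces E rot dout lab 1 v =
    {G \<in> bounded. \<exists>F\<in>bounded \<inter> fc ` {(x, y) \<in> F.arcs. (v, x) \<in> F.arcs\<^sup>*}. (F, G) \<in> (adj v)\<^sup>*}" for v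
    unfolding region_faces_def Let_def adj_def pathd_def path_darts_def path_arcs_def t0 t1
      bounded_def bounded_faces_def faces_def outer by (rule refl)
  show "fval V E rot dout s0 s1 lab 1 v = pos v"
  proof (cases "v \<in> inner")
    case True
    then obtain k where k: "k < length vs" "vs ! k = v"
      by (rule innerE)
    have "card (region_faces E rot dout lab 1 v) = k"
      unfolding region' k(2)[symmetric] region[OF k(1)] by (rule card_region[OF k(1)])
    then show ?thesis
      using True pos_nth[OF k(1)] k(2) by (simp add: fval_def)
  next
    case False
    have "s1 \<in> V"
      using labeled_map.s0_in[OF flip] .
    then have "V = insert s0 (insert s1 (set vs))" "s0 \<notin> set vs" "s1 \<notin> set vs"
      using s0_in set_spine by blast+
    then have "card V = length vs + 2"
      using s0_neq_s1 distinct_card[OF distinct_spine] by simp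
    then show ?thesis
      using False v pos_s0 pos_s1 s0_neq_s1 by (auto simp: fval_def)
  qed
qed

theorem theorem20:
  fixes V :: "'v set" and E :: "('v \<times> 'v) set" and rot :: "'v \<times> 'v \<Rightarrow> 'v \<times> 'v"
    and dout :: "'v \<times> 'v" and black :: "'v \<Rightarrow> bool" and s0 s1 :: 'v
    and lab :: "'v \<times> 'v \<Rightarrow> nat"
  assumes "quadrangulation V E rot dout black"
    and "strong_labeling V E rot dout black s0 s1 lab"
  shows "inj_on (fval V E rot dout s0 s1 lab 1) V \<and>
    (\<forall>l\<in>{0,1}.
       (\<forall>a b c d. tree_edge E rot lab l a c \<and> tree_edge E rot lab l b d \<longrightarrow>
          \<not> (fval V E rot dout s0 s1 lab 1 a < fval V E rot dout s0 s1 lab 1 b \<and>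
             fval V E rot dout s0 s1 lab 1 b < fval V E rot dout s0 s1 lab 1 c \<and>
             fval V E rot dout s0 s1 lab 1 c < fval V E rot dout s0 s1 lab 1 d)) \<and>
       (\<forall>i j k. tree_edge E rot lab l i j \<and> tree_edge E rot lab l j k \<longrightarrow>
          \<not> (fval V E rot dout s0 s1 lab 1 i < fval V E rot dout s0 s1 lab 1 j \<and>
             fval V E rot dout s0 s1 lab 1 j < fval V E rot dout s0 s1 lab 1 k))) \<and>
    (\<forall>(u,w)\<in>E. tree_edge E rot lab 0 u w \<or> tree_edge E rot lab 1 u w)"
proof -
  let ?L = "\<lambda>d. lab d = 1" and ?f = "fval V E rot dout s0 s1 lab 1"
  obtain d0 where d0: "labeled_map V E rot black ?L s0 s1 d0" "face_of rot d0 = outer_face rot dout"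
    using labeled_map_if_strong_labeling[OF assms] by blast
  obtain vs where vs: "spine V E rot black ?L s0 s1 d0 vs"
    using labeled_map.spine_exists[OF d0(1)] by blast
  interpret spine V E rot black ?L s0 s1 d0 vs
    by fact
  have lab01: "lab d = 0 \<or> lab d = 1" if "d \<in> E" for d
    using assms(2) that unfolding strong_labeling_def by blast
  note eq = fval_eq_pos[OF vs lab01 d0(2)]
  have f: "?f v = pos v" if "v \<in> V" for v
    using eq(1)[OF _ that] by blast
  have e0: "tree_edge E rot lab 0 x y \<longleftrightarrow> (x, y) \<in> arcs \<or> (y, x) \<in> arcs" for x y
    using eq(2)[OF _ s0_in] by (simp add: tree_edge_def)
  have e1: "tree_edge E rot lab 1 x y \<longleftrightarrow> (x, y) \<in> labeled_map.arcs E rot (\<lambda>d. \<not> lab d = 1) \<or>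
      (y, x) \<in> labeled_map.arcs E rot (\<lambda>d. \<not> lab d = 1)" for x y
    using eq(3)[OF _ s0_in] by (simp add: tree_edge_def)
  \<comment> \<open>\<open>?f\<close> is known to agree with \<open>pos\<close> only on
    \<open>V\<close>.\<close>
  have V: "x \<in> V \<and> y \<in> V" if "tree_edge E rot lab l x y" for x y l
    using that E_subset by (auto simp: tree_edge_def tree_arcs_def)
  show ?thesis
  proof (intro conjI ballI allI impI)
    show "inj_on ?f V"
      using inj_pos f by (simp cong: inj_on_cong)
  next
    fix l :: nat and a b c d
    assume "l \<in> {0, 1}" and e: "tree_edge E rot lab l a c \<and> tree_edge E rot lab l b d"
    then have "\<not> (pos a < pos b \<and> pos b < pos c \<and> pos c < pos d)"
      using noncrossing[of a c b d] noncrossing1[of a c b d] e0 e1 by blast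
    then show "\<not> (?f a < ?f b \<and> ?f b < ?f c \<and> ?f c < ?f d)"
      using e V f by metis
  next
    fix l :: nat and i j k
    assume "l \<in> {0, 1}" and e: "tree_edge E rot lab l i j \<and> tree_edge E rot lab l j k"
    then have "\<not> (pos i < pos j \<and> pos j < pos k)"
      using alternating[of i j k] alternating1[of i j k] e0 e1 by blast
    then show "\<not> (?f i < ?f j \<and> ?f j < ?f k)"
      using e V f by metis
  next
    fix d assume d: "d \<in> E"
    obtain u w where uw: "d = (u, w)" by (cases d)
    have "(w, u) \<in> arcs \<or> (u, w) \<in> arcs \<or> (w, u) \<in> labeled_map.arcs E rot (\<lambda>d. \<not> lab d = 1) \<or>
        (u, w) \<in> labeled_map.arcs E rot (\<lambda>d. \<not> lab d = 1)"
      using edge_arcs d unfolding uw .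
    then show "case d of (u, w) \<Rightarrow> tree_edge E rot lab 0 u w \<or> tree_edge E rot lab 1 u w"
      using e0 e1 uw by blast
  qed
qed

end
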